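(* Let $M=(\Omega,\lambda^2(\mathrm{d}x^2+\mathrm{d}y^2))$. The Lorentzian warped product $\mathbb{L}(M,0,\mu)$ admits an entire spacelike graph with prescribed mean curvature $H$ under any of the following two assumptions: (a) $\Omega\subseteq\mathbb{R}^2$ is a disk centered at the origin with radius $0<R\leq+\infty$, and $\lambda,\mu,H\in\mathcal{C}^\infty(\Omega)$ are radial functions such that $\lambda,\mu>0$. (b) $\Omega\subseteq\mathbb{R}^2$ is a strip of width $0<R\leq+\infty$, and $\lambda,\mu,H\in\mathcal{C}^\infty(\Omega)$ are functions invariant by translations along the strip such that $\lambda,\mu>0$.
   Context: $\mathbb{L}(M,0,\mu)$ is $\Omega\times\mathbb{R}$ with the Lorentzian metric $\lambda^2(\mathrm{d}x^2+\mathrm{d}y^2)-\mu^2\,\mathrm{d}z^2$. An open disk of radius $+\infty$ is $\mathbb{R}^2$. A strip of width $R$ is, up to a rigid motion of $\mathbb{R}^2$, a set $I\times\mathbb{R}$ with $I\subseteq\mathbb{R}$ an open interval of length $R\in(0,+\infty]$; translations along the strip are then those in the second coordinate, so invariant functions depend only on the first coordinate. An entire graph is $\{(x,y,v(x,y)):(x,y)\in\Omega\}$ with $v\in\mathcal{C}^\infty(\Omega)$; it is spacelike if its induced metric is Riemannian, which is equivalent to $\mu^2\|\nabla v\|^2<1$, where $\nabla$ and $\|\cdot\|$ are the gradient and norm in $M$. It has prescribed mean curvature $H$ if its mean curvature (with respect to the upward-pointing unit normal $N$, i.e. $\langle N,\partial_z\rangle<0$, with mean curvature vector $HN$) at $(x,y,v(x,y))$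 equals $H(x,y)$ for all $(x,y)\in\Omega$; equivalently, $H=\frac{1}{2\mu}\mathrm{div}\left(\frac{\mu^2\nabla v}{\sqrt{1-\mu^2\|\nabla v\|^2}}\right)$, with the divergence in $M$. *)

theory Defs
  imports "HOL-Analysis.Analysis"
begin

section \<open>Smooth functions\<close>

text \<open>
  On an open subset of a finite-dimensional space, \<open>Ck_on k\<close> is the usual class of \<open>k\<close> times
  continuously differentiable functions.
\<close>

primrec Ck_on :: "nat \<Rightarrow> 'a::real_normed_vector set \<Rightarrow> ('a \<Rightarrow> 'b::real_normed_vector) \<Rightarrow> bool" where
  "Ck_on 0 S f \<longleftrightarrow> continuous_on S f"
| "Ck_on (Suc k) S f \<longleftrightarrow>
     (\<forall>x\<in>S. f differentiable (at x)) \<and> (\<forall>w. Ck_on k S (\<lambda>x. frechet_derivative f (at x) w))"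

definition smooth_on :: "'a::real_normed_vector set \<Rightarrow> ('a \<Rightarrow> 'b::real_normed_vector) \<Rightarrow> bool" where
  "smooth_on S f \<longleftrightarrow> (\<forall>k. Ck_on k S f)"

definition partial_deriv :: "'n::finite \<Rightarrow> (real^'n \<Rightarrow> 'b::real_normed_vector) \<Rightarrow> real^'n \<Rightarrow> 'b" where
  "partial_deriv k f p = frechet_derivative f (at p) (axis k 1)"


section \<open>Pseudo-Riemannian metrics in global coordinates\<close>

text \<open>A metric is the field \<open>g\<close> of its Gram matrices with respect to the coordinate frame.\<close>

definition metric_inner :: "(real^'n \<Rightarrow> real^'n^'n) \<Rightarrow> real^'n \<Rightarrow> real^'n \<Rightarrow> real^'n \<Rightarrow> real" where
  "metric_inner g p u w = (\<Sum>i\<in>UNIV. \<Sum>j\<in>UNIV. g p $ i $ j * u $ i * w $ j)"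

text \<open>\<open>christoffel g p k i j\<close> is \<open>\<Gamma>\<close> with upper index \<open>k\<close> and lower indices \<open>i\<close>, \<open>j\<close>.\<close>

definition christoffel :: "(real^'n \<Rightarrow> real^'n^'n) \<Rightarrow> real^'n \<Rightarrow> 'n \<Rightarrow> 'n \<Rightarrow> 'n \<Rightarrow> real" where
  "christoffel g p k i j =
     (1/2) * (\<Sum>l\<in>UNIV. matrix_inv (g p) $ k $ l *
        (partial_deriv i (\<lambda>p'. g p' $ j $ l) p
         + partial_deriv j (\<lambda>p'. g p' $ i $ l) p
         - partial_deriv l (\<lambda>p'. g p' $ i $ j) p))"


section \<open>Parametrized surfaces\<close>

text \<open>
  In this section \<open>g\<close> is a metric on (an open part of) three-dimensional space and \<open>X\<close> is a
  surface parametrized by (an open part of) the plane.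
\<close>

definition induced_metric ::
    "(real^3 \<Rightarrow> real^3^3) \<Rightarrow> (real^2 \<Rightarrow> real^3) \<Rightarrow> real^2 \<Rightarrow> real^2^2" where
  "induced_metric g X q =
     (\<chi> a b. metric_inner g (X q) (partial_deriv a X q) (partial_deriv b X q))"

definition spacelike_on :: "(real^3 \<Rightarrow> real^3^3) \<Rightarrow> (real^2) set \<Rightarrow> (real^2 \<Rightarrow> real^3) \<Rightarrow> bool" where
  "spacelike_on g S X \<longleftrightarrow>
     (\<forall>q\<in>S. \<forall>u. u \<noteq> 0 \<longrightarrow> 0 < metric_inner (induced_metric g X) q u u)"

text \<open>The ambient Levi-Civita derivative of the coordinate field \<open>\<partial>\<^sub>b X\<close> in the direction \<open>\<partial>\<^sub>a X\<close>.\<close>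

definition ambient_covariant ::
    "(real^3 \<Rightarrow> real^3^3) \<Rightarrow> (real^2 \<Rightarrow> real^3) \<Rightarrow> real^2 \<Rightarrow> 2 \<Rightarrow> 2 \<Rightarrow> real^3" where
  "ambient_covariant g X q a b =
     partial_deriv a (partial_deriv b X) q
     + (\<chi> k. \<Sum>i\<in>UNIV. \<Sum>j\<in>UNIV.
          christoffel g (X q) k i j * partial_deriv a X q $ i * partial_deriv b X q $ j)"

text \<open>Orthogonal projection onto the normal space: \<open>w\<close> minus its tangential part.\<close>

definition normal_part ::
    "(real^3 \<Rightarrow> real^3^3) \<Rightarrow> (real^2 \<Rightarrow> real^3) \<Rightarrow> real^2 \<Rightarrow> real^3 \<Rightarrow> real^3" where
  "normal_part g X q w =
     w - (\<Sum>a\<in>UNIV. \<Sum>b\<in>UNIV.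
            (matrix_inv (induced_metric g X q) $ a $ b
              * metric_inner g (X q) w (partial_deriv a X q)) *\<^sub>R partial_deriv b X q)"

definition second_fundamental_form ::
    "(real^3 \<Rightarrow> real^3^3) \<Rightarrow> (real^2 \<Rightarrow> real^3) \<Rightarrow> real^2 \<Rightarrow> 2 \<Rightarrow> 2 \<Rightarrow> real^3" where
  "second_fundamental_form g X q a b = normal_part g X q (ambient_covariant g X q a b)"

text \<open>Half of the trace of the second fundamental form, so that mean curvature is an average.\<close>

definition mean_curvature_vector ::
    "(real^3 \<Rightarrow> real^3^3) \<Rightarrow> (real^2 \<Rightarrow> real^3) \<Rightarrow> real^2 \<Rightarrow> real^3" where
  "mean_curvature_vector g X q =
     (1/2) *\<^sub>R (\<Sum>a\<in>UNIV. \<Sum>b\<in>UNIV.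
        matrix_inv (induced_metric g X q) $ a $ b *\<^sub>R second_fundamental_form g X q a b)"

text \<open>
  The normal of a spacelike surface is timelike, hence has square \<open>-1\<close>; as \<open>\<partial>\<^sub>z\<close> is timelike too,
  pointing upwards means having negative product with it.
\<close>

definition upward_unit_normal ::
    "(real^3 \<Rightarrow> real^3^3) \<Rightarrow> (real^2 \<Rightarrow> real^3) \<Rightarrow> real^2 \<Rightarrow> real^3 \<Rightarrow> bool" where
  "upward_unit_normal g X q N \<longleftrightarrow>
     (\<forall>a. metric_inner g (X q) N (partial_deriv a X q) = 0)
     \<and> metric_inner g (X q) N N = - 1
     \<and> metric_inner g (X q) N (axis 3 1) < 0"

definition prescribed_mean_curvature ::
    "(real^3 \<Rightarrow> real^3^3) \<Rightarrow> (real^2) set \<Rightarrow> (real^2 \<Rightarrow> real^3) \<Rightarrow> (real^2 \<Rightarrow> real) \<Rightarrow> bool" where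
  "prescribed_mean_curvature g S X H \<longleftrightarrow>
     (\<forall>q\<in>S. \<exists>N. upward_unit_normal g X q N \<and> mean_curvature_vector g X q = H q *\<^sub>R N)"


section \<open>The Lorentzian warped product and its entire graphs\<close>

text \<open>
  The metric \<open>\<lambda>\<^sup>2 (dx\<^sup>2 + dy\<^sup>2) - \<mu>\<^sup>2 dz\<^sup>2\<close> of \<open>L(M,0,\<mu>)\<close>. It is only meaningful at points
  whose first two coordinates lie in the open set where \<open>lam\<close> and \<open>mu\<close> are smooth and positive.
\<close>

definition base_point :: "real^3 \<Rightarrow> real^2" where
  "base_point p = vector [p $ 1, p $ 2]"

definition lorentz_warped_metric ::
    "(real^2 \<Rightarrow> real) \<Rightarrow> (real^2 \<Rightarrow> real) \<Rightarrow> real^3 \<Rightarrow> real^3^3" where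
  "lorentz_warped_metric lam mu p =
     (\<chi> i j. if i \<noteq> j then 0
             else if i = 3 then - (mu (base_point p))\<^sup>2
             else (lam (base_point p))\<^sup>2)"

definition graph_param :: "(real^2 \<Rightarrow> real) \<Rightarrow> real^2 \<Rightarrow> real^3" where
  "graph_param v q = vector [q $ 1, q $ 2, v q]"

definition admits_entire_spacelike_graph ::
    "(real^2) set \<Rightarrow> (real^2 \<Rightarrow> real) \<Rightarrow> (real^2 \<Rightarrow> real) \<Rightarrow> (real^2 \<Rightarrow> real) \<Rightarrow> bool" where
  "admits_entire_spacelike_graph \<Omega> lam mu H \<longleftrightarrow>
     (\<exists>v. smooth_on \<Omega> v
        \<and> spacelike_on (lorentz_warped_metric lam mu) \<Omega> (graph_param v)
        \<and> prescribed_mean_curvature (lorentz_warped_metric lam mu) \<Omega> (graph_param v) H)"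


section \<open>Disks and strips\<close>

definition centered_disk :: "ereal \<Rightarrow> (real^2) set" where
  "centered_disk R = {p. ereal (norm p) < R}"

definition radial_on :: "(real^2) set \<Rightarrow> (real^2 \<Rightarrow> real) \<Rightarrow> bool" where
  "radial_on \<Omega> f \<longleftrightarrow> (\<forall>p\<in>\<Omega>. \<forall>q\<in>\<Omega>. norm p = norm q \<longrightarrow> f p = f q)"

definition rigid_motion :: "(real^2 \<Rightarrow> real^2) \<Rightarrow> bool" where
  "rigid_motion \<phi> \<longleftrightarrow> (\<exists>A c. orthogonal_transformation A \<and> \<phi> = (\<lambda>p. c + A p))"

text \<open>
  The interval of a vertical strip may be bounded, a half-line or the whole line; its width
  is \<open>b - a\<close>.
\<close>

definition vertical_strip :: "ereal \<Rightarrow> ereal \<Rightarrow> (real^2) set" where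
  "vertical_strip a b = {p. p $ 1 \<in> einterval a b}"

definition is_strip_via :: "(real^2 \<Rightarrow> real^2) \<Rightarrow> ereal \<Rightarrow> (real^2) set \<Rightarrow> bool" where
  "is_strip_via \<phi> R \<Omega> \<longleftrightarrow>
     rigid_motion \<phi> \<and> (\<exists>a b. a < b \<and> b - a = R \<and> \<Omega> = \<phi> ` vertical_strip a b)"

text \<open>
  Translations along the strip depend on the rigid motion \<open>\<phi>\<close> and not only on the set \<open>\<Omega>\<close>,
  because the whole plane is a strip in every direction.
\<close>

definition strip_invariant :: "(real^2 \<Rightarrow> real^2) \<Rightarrow> (real^2) set \<Rightarrow> (real^2 \<Rightarrow> real) \<Rightarrow> bool" where
  "strip_invariant \<phi> \<Omega> f \<longleftrightarrow>
     (\<forall>p t. \<phi> p \<in> \<Omega> \<longrightarrow> f (\<phi> (p + t *\<^sub>R axis 2 1)) = f (\<phi> p))"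

end

theory Submission
  imports Defs
begin

text \<open>
  Both cases are treated at once. Let \<open>Z x = Q (x - c)\<close>, where \<open>c\<close> is the centre of the disk and
  \<open>Q\<close> the identity, or \<open>c\<close> is a point of the strip and \<open>Q\<close> the orthogonal projection onto the
  direction across it; let \<open>m + 1\<close> be the rank of \<open>Q\<close>. The prescribed mean curvature equation says
  that the flux \<open>\<mu>\<^sup>2 Dv / sqrt (1 - \<mu>\<^sup>2 |Dv|\<^sup>2 / \<lambda>\<^sup>2)\<close> has Euclidean divergence \<open>K = 2 \<mu> \<lambda>\<^sup>2 H\<close>.
  The field \<open>P Z\<close> with \<open>P x = \<integral>\<^sub>0\<^sup>1 t\<^sup>m K (c + t (x - c)) dt\<close> has this divergence, and \<open>P\<close> is
  smooth even where \<open>Z\<close> vanishes. Solving for \<open>Dv\<close> gives \<open>Dv = W Z\<close> with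
  \<open>W = \<lambda> P / (\<mu> sqrt (\<lambda>\<^sup>2 \<mu>\<^sup>2 + |Z|\<^sup>2 P\<^sup>2))\<close>, which is automatically spacelike, and by the symmetry
  \<open>v x = |Z x|\<^sup>2 \<integral>\<^sub>0\<^sup>1 t W (c + t (x - c)) dt\<close> is a potential of \<open>W Z\<close>.
\<close>

section \<open>Smooth functions and averages along rays\<close>

lemma Ck_on_cong:
  assumes "open S" "Ck_on k S f" "\<And>x. x \<in> S \<Longrightarrow> f x = g x"
  shows "Ck_on k S g"
  using assms(2,3)
proof (induction k arbitrary: f g)
  case 0
  then show ?case
    using continuous_on_cong[of S S f g] by simp
next
  case (Suc k)
  \<comment> \<open>\<open>S\<close> is open, so the derivative at a point of \<open>S\<close>
    depends only on the values taken in \<open>S\<close>.\<close>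
  have der: "(g has_derivative frechet_derivative f (at x)) (at x)" if "x \<in> S" for x
    by (rule has_derivative_transform_within_open[where f = f, OF _ assms(1) that])
      (use Suc.prems that frechet_derivative_works in auto)
  then have eq: "frechet_derivative g (at x) = frechet_derivative f (at x)" if "x \<in> S" for x
    using frechet_derivative_at[OF der[OF that]] by simp
  have "Ck_on k S (\<lambda>x. frechet_derivative g (at x) w)" for w
    by (rule Suc.IH[where f = "\<lambda>x. frechet_derivative f (at x) w"]) (use Suc.prems eq in auto)
  then show ?case
    using der by (auto simp: differentiable_def)
qed

text \<open>By uniqueness of derivatives, any explicit formula may stand for
  \<open>frechet_derivative\<close> on \<open>S\<close>. The inductions on \<open>k\<close> below
  therefore compute with the sum, product and chain rules directly.\<close>

lemma Ck_on_SucI: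
  assumes "open S" "\<And>x. x \<in> S \<Longrightarrow> (f has_derivative f' x) (at x)" "\<And>w. Ck_on k S (\<lambda>x. f' x w)"
  shows "Ck_on (Suc k) S f"
proof -
  have "Ck_on k S (\<lambda>x. frechet_derivative f (at x) w)" for w
    by (rule Ck_on_cong[OF assms(1) assms(3)[of w]]) (simp add: frechet_derivative_at[OF assms(2)])
  then show ?thesis
    using assms(2) by (auto simp: differentiable_def)
qed

lemma Ck_on_SucD: "Ck_on (Suc k) S f \<Longrightarrow> Ck_on k S f"
proof (induction k arbitrary: f)
  case 0
  then show ?case
    by (auto intro!: continuous_at_imp_continuous_on differentiable_imp_continuous_within)
next
  case (Suc k)
  then show ?case
    unfolding Ck_on.simps(2)[of "Suc k"] by (subst Ck_on.simps(2)) blast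
qed

lemma Ck_on_antimono: "Ck_on k S f \<Longrightarrow> m \<le> k \<Longrightarrow> Ck_on m S f"
  by (induction k) (auto simp: le_Suc_eq simp del: Ck_on.simps dest: Ck_on_SucD)

lemma Ck_on_has_derivative:
  "Ck_on (Suc k) S f \<Longrightarrow> x \<in> S \<Longrightarrow> (f has_derivative frechet_derivative f (at x)) (at x)"
  by (simp add: frechet_derivative_works)

lemma Ck_on_const: "Ck_on k S (\<lambda>x. c)"
  by (induction k arbitrary: c) auto

lemma Ck_on_bounded_linear:
  assumes "bounded_linear F" "open S"
  shows "Ck_on k S F"
proof (cases k)
  case 0
  then show ?thesis
    by (simp add: assms(1) linear_continuous_on)
next
  case (Suc n)
  then show ?thesis
    using Ck_on_SucI[OF assms(2) bounded_linear_imp_has_derivative[OF assms(1)] Ck_on_const] by simp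
qed

lemma Ck_on_add:
  assumes "open S"
  shows "Ck_on k S f \<Longrightarrow> Ck_on k S g \<Longrightarrow> Ck_on k S (\<lambda>x. f x + g x)"
proof (induction k arbitrary: f g)
  case 0
  then show ?case by (auto intro: continuous_intros)
next
  case (Suc k)
  show ?case
  proof (rule Ck_on_SucI[OF assms])
    show "((\<lambda>x. f x + g x) has_derivative
        (\<lambda>w. frechet_derivative f (at x) w + frechet_derivative g (at x) w)) (at x)" if "x \<in> S" for x
      by (intro has_derivative_add Suc.prems[THEN Ck_on_has_derivative] that)
  qed (use Suc in auto)
qed

lemma Ck_on_mult:
  fixes f g :: "'a::real_normed_vector \<Rightarrow> 'b::real_normed_algebra"
  assumes "open S"
  shows "Ck_on k S f \<Longrightarrow> Ck_on k S g \<Longrightarrow> Ck_on k S (\<lambda>x. f x * g x)"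
proof (induction k arbitrary: f g)
  case 0
  then show ?case by (auto intro: continuous_intros)
next
  case (Suc k)
  show ?case
  proof (rule Ck_on_SucI[OF assms])
    show "((\<lambda>x. f x * g x) has_derivative
        (\<lambda>w. f x * frechet_derivative g (at x) w + frechet_derivative f (at x) w * g x)) (at x)"
      if "x \<in> S" for x
      by (intro has_derivative_mult Suc.prems[THEN Ck_on_has_derivative] that)
    show "Ck_on k S (\<lambda>x. f x * frechet_derivative g (at x) w + frechet_derivative f (at x) w * g x)" for w
      using Suc.prems Ck_on_SucD[OF Suc.prems(1)] Ck_on_SucD[OF Suc.prems(2)]
      by (intro Ck_on_add[OF assms] Suc.IH) simp_all
  qed
qed

text \<open>The derivative of \<open>r = inverse (sqrt f)\<close> is \<open>- 1 / 2\<close> times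
  the product of three copies of \<open>r\<close> and the derivative of \<open>f\<close>. It is
  built from \<open>r\<close> itself, so the induction closes with the product rule alone; every
  quotient needed later is brought to this form.\<close>

lemma Ck_on_inverse_sqrt:
  fixes f :: "'a::real_normed_vector \<Rightarrow> real"
  assumes "open S" and pos: "\<And>x. x \<in> S \<Longrightarrow> 0 < f x"
  shows "Ck_on k S f \<Longrightarrow> Ck_on k S (\<lambda>x. inverse (sqrt (f x)))"
proof (induction k)
  case 0
  then show ?case
    by (auto intro!: continuous_intros dest: pos)
next
  case (Suc k)
  let ?r = "\<lambda>x. inverse (sqrt (f x))"
  show ?case
  proof (rule Ck_on_SucI[OF assms(1)])
    show "(?r has_derivative
        (\<lambda>w. (- 1 / 2) * (?r x * (?r x * (?r x * frechet_derivative f (at x) w))))) (at x)"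
      if "x \<in> S" for x
      using pos[OF that] Ck_on_has_derivative[OF Suc.prems that]
      by (auto intro!: derivative_eq_intros simp: field_simps)
    show "Ck_on k S (\<lambda>x. (- 1 / 2) * (?r x * (?r x * (?r x * frechet_derivative f (at x) w))))" for w
      using Suc Ck_on_SucD[OF Suc.prems] by (intro Ck_on_mult[OF assms(1)] Ck_on_const) simp_all
  qed
qed

section \<open>Weighted averages along the rays from a centre\<close>

definition ray_average :: "'a::euclidean_space \<Rightarrow> nat \<Rightarrow> ('a \<Rightarrow> real) \<Rightarrow> 'a \<Rightarrow> real" where
  "ray_average c n f x = integral {0..1} (\<lambda>t. t ^ n * f (c + t *\<^sub>R (x - c)))"

lemma ray_in:
  assumes "convex S" "c \<in> S" "x \<in> S" "t \<in> {0..1::real}"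
  shows "c + t *\<^sub>R (x - c) \<in> S"
  using convexD_alt[OF assms(1-3), of t] assms(4) by (simp add: algebra_simps)

lemma continuous_on_ray:
  fixes c :: "'a::real_normed_vector"
  assumes "convex S" "c \<in> S" "continuous_on S f"
  shows "continuous_on (S \<times> {0..1::real}) (\<lambda>(x, t). f (c + t *\<^sub>R (x - c)))"
  unfolding case_prod_unfold
  by (rule continuous_on_compose2[OF assms(3)])
    (auto intro!: continuous_intros ray_in[OF assms(1,2)])

lemma continuous_on_ray_integrand:
  fixes f :: "'a::real_normed_vector \<Rightarrow> real"
  assumes "convex S" "c \<in> S" "continuous_on S f"
  shows "continuous_on (S \<times> {0..1::real}) (\<lambda>(x, t). t ^ n * f (c + t *\<^sub>R (x - c)))"
  using continuous_on_ray[OF assms] by (simp add: case_prod_unfold continuous_intros)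

lemma integrable_ray_integrand:
  fixes f :: "'a::real_normed_vector \<Rightarrow> real"
  assumes "convex S" "c \<in> S" "continuous_on S f" "x \<in> S"
  shows "(\<lambda>t. t ^ n * f (c + t *\<^sub>R (x - c))) integrable_on {0..1::real}"
  by (rule integrable_continuous_interval)
    (auto intro!: continuous_intros continuous_on_compose2[OF assms(3)] ray_in[OF assms(1,2,4)])

text \<open>Differentiation under the integral sign. The chain rule along the ray produces a factor
  \<open>t\<close>, which raises the exponent of the weight by one; this is why averages with all
  exponents are considered.\<close>

lemma ray_average_has_derivative:
  fixes f :: "'a::euclidean_space \<Rightarrow> real"
  assumes "open S" "convex S" "c \<in> S" "Ck_on 1 S f" "x \<in> S"
  shows "(ray_average c n f has_derivative
    (\<lambda>w. ray_average c (Suc n) (\<lambda>y. frechet_derivative f (at y) w) x)) (at x)"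
proof -
  let ?ray = "\<lambda>x t. c + t *\<^sub>R (x - c)"
  define D where "D x = frechet_derivative f (at x)" for x
  \<comment> \<open>The Leibniz rule asks for a family of bounded linear maps that is continuous in
    the operator norm. In finite dimension this continuity can be checked on basis vectors.\<close>
  define F where "F x t = Blinfun (\<lambda>w. t ^ Suc n * D (?ray x t) w)" for x t
  have der: "(f has_derivative D y) (at y)" if "y \<in> S" for y
    unfolding D_def using Ck_on_has_derivative[of 0] assms(4) that by simp
  have cont: "continuous_on S (\<lambda>y. D y w)" for w
    using assms(4) by (simp add: D_def)
  have contf: "continuous_on S f"
    using Ck_on_SucD[of 0] assms(4) by simp
  have F: "blinfun_apply (F y t) = (\<lambda>w. t ^ Suc n * D (?ray y t) w)" if "y \<in> S" "t \<in> {0..1}" for y t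
    unfolding F_def
    by (intro bounded_linear_Blinfun_apply bounded_linear_const_mult
        has_derivative_bounded_linear[OF der[OF ray_in[OF assms(2,3) that]]])
  have Fcont: "continuous_on (S \<times> {0..1}) (\<lambda>(y, t). F y t)"
  proof (rule continuous_on_blinfun_componentwise)
    fix i :: 'a
    have "continuous_on (S \<times> {0..1}) (\<lambda>(y, t). t ^ Suc n * D (?ray y t) i)"
      by (rule continuous_on_ray_integrand[OF assms(2,3) cont])
    then show "continuous_on (S \<times> {0..1}) (\<lambda>z. blinfun_apply (case z of (y, t) \<Rightarrow> F y t) i)"
      by (rule continuous_on_cong[THEN iffD1, OF refl, rotated]) (auto simp: F)
  qed
  have "((\<lambda>x. integral (cbox 0 1) (\<lambda>t. t ^ n * f (?ray x t))) has_derivative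
      blinfun_apply (integral (cbox 0 1) (F x))) (at x within S)"
  proof (rule leibniz_rule)
    fix y t assume y: "y \<in> S" and t: "t \<in> cbox 0 (1::real)"
    have "((\<lambda>x. f (?ray x t)) has_derivative (\<lambda>w. D (?ray y t) (t *\<^sub>R w))) (at y)"
      by (rule has_derivative_compose[where f = "\<lambda>x. ?ray x t", OF _ der])
        (use ray_in[OF assms(2,3) y] t in \<open>auto intro!: derivative_eq_intros\<close>)
    then have "((\<lambda>x. t ^ n * f (?ray x t)) has_derivative (\<lambda>w. t ^ n * D (?ray y t) (t *\<^sub>R w))) (at y)"
      by (rule has_derivative_mult_right)
    moreover have "(\<lambda>w. t ^ n * D (?ray y t) (t *\<^sub>R w)) = blinfun_apply (F y t)"
      using F[OF y] t linear_scale[OF has_derivative_linear[OF der[OF ray_in[OF assms(2,3) y]]]]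
      by (auto simp: fun_eq_iff)
    ultimately show "((\<lambda>x. t ^ n * f (?ray x t)) has_derivative blinfun_apply (F y t)) (at y within S)"
      using has_derivative_at_withinI by fastforce
  qed (use assms Fcont integrable_ray_integrand[OF assms(2,3) contf] in \<open>auto simp: cbox_interval\<close>)
  moreover have "blinfun_apply (integral (cbox 0 1) (F x)) w
      = ray_average c (Suc n) (\<lambda>y. frechet_derivative f (at y) w) x" for w
  proof -
    have "F x integrable_on {0..1}"
      by (rule integrable_continuous_interval)
        (rule continuous_on_compose2[OF Fcont, where f = "\<lambda>t. (x, t)", simplified case_prod_conv],
          use assms(5) in \<open>auto intro!: continuous_intros\<close>)
    then have "blinfun_apply (integral {0..1} (F x)) w = integral {0..1} (\<lambda>t. blinfun_apply (F x t) w)"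
      by (simp add: blinfun_apply_integral)
    also have "\<dots> = integral {0..1} (\<lambda>t. t ^ Suc n * D (?ray x t) w)"
      by (rule integral_cong) (simp add: F assms(5))
    finally show ?thesis
      by (simp add: ray_average_def D_def cbox_interval)
  qed
  then have "blinfun_apply (integral (cbox 0 1) (F x))
      = (\<lambda>w. ray_average c (Suc n) (\<lambda>y. frechet_derivative f (at y) w) x)"
    by (rule ext)
  ultimately show ?thesis
    using at_within_open[OF assms(5,1)] by (simp add: ray_average_def[abs_def] cbox_interval)
qed

text \<open>The derivative of an average is an average of a derivative, with another exponent. The
  induction is therefore over \<open>k\<close> with \<open>f\<close> and \<open>n\<close>
  arbitrary.\<close>

lemma Ck_on_ray_average:
  fixes f :: "'a::euclidean_space \<Rightarrow> real"
  assumes "open S" "convex S" "c \<in> S"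
  shows "Ck_on k S f \<Longrightarrow> Ck_on k S (ray_average c n f)"
proof (induction k arbitrary: f n)
  case 0
  then have "continuous_on (S \<times> cbox 0 (1::real)) (\<lambda>(x, t). t ^ n * f (c + t *\<^sub>R (x - c)))"
    using continuous_on_ray_integrand[OF assms(2,3)] by (simp add: cbox_interval)
  then show ?case
    using integral_continuous_on_param[of S 0 1 "\<lambda>x t. t ^ n * f (c + t *\<^sub>R (x - c))"]
    by (simp add: ray_average_def[abs_def] cbox_interval)
next
  case (Suc k)
  have "Ck_on 1 S f"
    using Suc.prems by (rule Ck_on_antimono) simp
  then show ?case
    using Suc by (intro Ck_on_SucI[OF assms(1) ray_average_has_derivative[OF assms]]) auto
qed

text \<open>Integration by parts of \<open>t \<mapsto> t ^ Suc n * f\<close> along the ray.\<close>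

lemma ray_average_radial_derivative:
  fixes f :: "'a::euclidean_space \<Rightarrow> real"
  assumes "open S" "convex S" "c \<in> S" "Ck_on 1 S f" "x \<in> S"
  shows "ray_average c (Suc n) (\<lambda>y. frechet_derivative f (at y) (x - c)) x
    = f x - Suc n * ray_average c n f x"
proof -
  let ?ray = "\<lambda>t. c + t *\<^sub>R (x - c)"
  define D where "D y = frechet_derivative f (at y) (x - c)" for y
  have der: "(f has_derivative frechet_derivative f (at y)) (at y)" if "y \<in> S" for y
    using Ck_on_has_derivative[of 0] assms(4) that by simp
  have contf: "continuous_on S f" and contD: "continuous_on S D"
    using Ck_on_SucD[of 0] assms(4) by (simp_all add: D_def)
  have ray: "((\<lambda>t. f (?ray t)) has_real_derivative D (?ray t)) (at t within {0..1})"
    if "t \<in> {0..1}" for t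
  proof -
    have "((\<lambda>t. f (?ray t)) has_derivative (\<lambda>s. frechet_derivative f (at (?ray t)) (s *\<^sub>R (x - c))))
        (at t within {0..1})"
      by (rule has_derivative_compose[where f = ?ray, OF _ der[OF ray_in[OF assms(2,3,5) that]]])
        (auto intro!: derivative_eq_intros)
    moreover have "(\<lambda>s. frechet_derivative f (at (?ray t)) (s *\<^sub>R (x - c))) = (*) (D (?ray t))"
      using linear_scale[OF has_derivative_linear[OF der[OF ray_in[OF assms(2,3,5) that]]]]
      by (auto simp: D_def mult.commute)
    ultimately show ?thesis
      by (simp add: has_field_derivative_def)
  qed
  \<comment> \<open>The exponent \<open>Suc n\<close> is positive, so the boundary term at
    \<open>t = 0\<close> vanishes and the one at \<open>t = 1\<close> gives
    \<open>f x\<close>.\<close>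
  have "((\<lambda>t. Suc n * (t ^ n * f (?ray t)) + t ^ Suc n * D (?ray t)) has_integral
      1 ^ Suc n * f (?ray 1) - 0 ^ Suc n * f (?ray 0)) {0..1::real}"
  proof (rule fundamental_theorem_of_calculus)
    fix t :: real assume "t \<in> {0..1}"
    note der_t = DERIV_mult[OF DERIV_pow[of "Suc n"] ray[OF this]]
    show "((\<lambda>t. t ^ Suc n * f (?ray t)) has_vector_derivative
        Suc n * (t ^ n * f (?ray t)) + t ^ Suc n * D (?ray t)) (at t within {0..1})"
      unfolding has_real_derivative_iff_has_vector_derivative[symmetric]
      by (rule DERIV_cong[OF der_t]) (simp only: diff_Suc_Suc diff_zero mult.assoc mult.commute)
  qed simp
  then have "integral {0..1} (\<lambda>t. Suc n * (t ^ n * f (?ray t)) + t ^ Suc n * D (?ray t))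
      = 1 ^ Suc n * f (?ray 1) - 0 ^ Suc n * f (?ray 0)"
    by (rule integral_unique)
  moreover have "integral {0..1} (\<lambda>t. Suc n * (t ^ n * f (?ray t)) + t ^ Suc n * D (?ray t))
      = Suc n * ray_average c n f x + ray_average c (Suc n) D x"
    unfolding ray_average_def
    using integrable_ray_integrand[OF assms(2,3) contf assms(5), of n]
      integrable_ray_integrand[OF assms(2,3) contD assms(5), of "Suc n"]
    by (subst integral_add) (simp_all only: integrable_on_mult_right integral_mult_right)
  ultimately show ?thesis
    by (simp add: D_def[abs_def])
qed

section \<open>Mean curvature of entire graphs\<close>

lemma base_point_graph_param [simp]: "base_point (graph_param v q) = q"
  by (simp add: base_point_def graph_param_def vec_eq_iff forall_2)

lemma bounded_linear_base_point: "bounded_linear base_point"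
proof -
  have "linear base_point"
    by (rule linearI) (simp_all add: base_point_def vec_eq_iff forall_2)
  then show ?thesis
    by (rule linear_conv_bounded_linear[THEN iffD1])
qed

lemma base_point_axis [simp]:
  "base_point (axis 1 1) = axis 1 1" "base_point (axis 2 1) = axis 2 1" "base_point (axis 3 1) = 0"
  by (simp_all add: base_point_def vec_eq_iff forall_2 axis_def)

text \<open>\<open>matrix_inv\<close> is a choice among two-sided inverses. Over a field a right
  inverse of a square matrix is two-sided, and two-sided inverses are unique.\<close>

lemma matrix_inv_unique:
  fixes A B :: "'a::field^'n^'n"
  assumes "A ** B = mat 1"
  shows "matrix_inv A = B"
proof -
  have BA: "B ** A = mat 1"
    using assms matrix_left_right_inverse by blast
  have "A ** matrix_inv A = mat 1"
    unfolding matrix_inv_def using someI[of "\<lambda>B. A ** B = mat 1 \<and> B ** A = mat 1"] assms BA by blast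
  then show ?thesis
    by (metis BA matrix_mul_assoc matrix_mul_lid matrix_mul_rid)
qed

lemma partial_deriv_eq: "(f has_derivative f') (at p) \<Longrightarrow> partial_deriv k f p = f' (axis k 1)"
  unfolding partial_deriv_def by (simp flip: frechet_derivative_at)

section \<open>Inverse and Christoffel symbols of the warped metric\<close>

lemma metric_inner_lorentz:
  "metric_inner (lorentz_warped_metric lam mu) x u w
    = (lam (base_point x))\<^sup>2 * (u $ 1 * w $ 1 + u $ 2 * w $ 2) - (mu (base_point x))\<^sup>2 * (u $ 3 * w $ 3)"
  by (simp add: metric_inner_def lorentz_warped_metric_def sum_3 algebra_simps)

lemma matrix_inv_lorentz:
  assumes "lam (base_point x) \<noteq> 0" "mu (base_point x) \<noteq> 0"
  shows "matrix_inv (lorentz_warped_metric lam mu x) =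
     (\<chi> i j. if i \<noteq> j then 0
             else if i = 3 then - inverse ((mu (base_point x))\<^sup>2)
             else inverse ((lam (base_point x))\<^sup>2))"
  by (rule matrix_inv_unique)
    (use assms in \<open>simp add: lorentz_warped_metric_def matrix_matrix_mult_def mat_def vec_eq_iff
      forall_3 sum_3\<close>)

text \<open>The metric is diagonal, so only \<open>l = k\<close> survives in the sum, and
  \<open>P i j l\<close> is the derivative of its entry \<open>j l\<close> in direction
  \<open>i\<close>. Only the squares of \<open>lam\<close> and \<open>mu\<close> enter the metric,
  so only their derivatives are assumed. Independence of \<open>z\<close> is encoded by
  \<open>base_point (axis 3 1) = 0\<close>.\<close>

lemma christoffel_lorentz:
  fixes lam mu :: "real^2 \<Rightarrow> real"
  defines "gd \<equiv> \<lambda>p (j::3). if j = 3 then - (mu p)\<^sup>2 else (lam p)\<^sup>2"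
  assumes L: "((\<lambda>x. (lam x)\<^sup>2) has_derivative L') (at (base_point x))"
    and M: "((\<lambda>x. (mu x)\<^sup>2) has_derivative M') (at (base_point x))"
    and nz: "lam (base_point x) \<noteq> 0" "mu (base_point x) \<noteq> 0"
  defines "P \<equiv> \<lambda>i j l::3. if j \<noteq> l then 0 else if j = 3 then - M' (base_point (axis i 1))
             else L' (base_point (axis i 1))"
  shows "christoffel (lorentz_warped_metric lam mu) x k i j
    = (1/2) * inverse (gd (base_point x) k) * (P i j k + P j i k - P k i j)"
proof -
  have base: "((\<lambda>p. f (base_point p)) has_derivative (\<lambda>w. f' (base_point w))) (at x)"
    if "(f has_derivative f') (at (base_point x))" for f f' :: "real^2 \<Rightarrow> real"
    by (rule has_derivative_compose[OF bounded_linear_imp_has_derivative[OF bounded_linear_base_point] that])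
  have P: "partial_deriv i (\<lambda>p. lorentz_warped_metric lam mu p $ j $ l) x = P i j l" for i j l
  proof -
    have "((\<lambda>p. lorentz_warped_metric lam mu p $ j $ l) has_derivative
        (\<lambda>w. if j \<noteq> l then 0 else if j = 3 then - M' (base_point w) else L' (base_point w))) (at x)"
      using base[OF L] has_derivative_minus[OF base[OF M]]
      by (cases "j = l"; cases "j = 3") (simp_all add: lorentz_warped_metric_def)
    from partial_deriv_eq[OF this] show ?thesis
      by (simp add: P_def)
  qed
  have "matrix_inv (lorentz_warped_metric lam mu x) $ k $ l
      = (if l = k then inverse (gd (base_point x) k) else 0)" for l
    using matrix_inv_lorentz[of lam x mu, OF nz] by (auto simp: gd_def)
  then show ?thesis
    unfolding christoffel_def P by (simp add: if_distrib[of "\<lambda>z. z * _"] cong: if_cong)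
qed

section \<open>First and second derivatives of a graph\<close>

lemma has_derivative_graph_param:
  assumes "(v has_derivative (\<lambda>h. G \<bullet> h)) (at q)"
  shows "(graph_param v has_derivative (\<lambda>h. vector [h $ 1, h $ 2, G \<bullet> h])) (at q)"
proof -
  have "((\<lambda>x. graph_param v x $ i) has_derivative (\<lambda>h. vector [h $ 1, h $ 2, G \<bullet> h] $ i)) (at q)" for i
    using exhaust_3[of i] assms
    by (auto simp: graph_param_def bounded_linear_imp_has_derivative bounded_linear_vec_nth)
  then show ?thesis
    by (subst has_derivative_componentwise_within) (auto simp: Basis_vec_def inner_axis)
qed

lemma partial_deriv_graph_param:
  assumes "(v has_derivative (\<lambda>h. G \<bullet> h)) (at q)"
  shows "partial_deriv 1 (graph_param v) q = vector [1, 0, G $ 1]"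
    and "partial_deriv 2 (graph_param v) q = vector [0, 1, G $ 2]"
  unfolding partial_deriv_eq[OF has_derivative_graph_param[OF assms]]
  by (simp_all add: inner_axis axis_def inner_vec_def sum_2 vec_eq_iff forall_3)

text \<open>The first two components of the graph are coordinates, with constant derivatives, so
  only the Hessian entry of \<open>v\<close> remains. The gradient must be known on a neighbourhood
  of \<open>q\<close> to be differentiated at \<open>q\<close>.\<close>

lemma partial_deriv_partial_deriv_graph_param:
  assumes "open S" "q \<in> S"
    and v: "\<And>x. x \<in> S \<Longrightarrow> (v has_derivative (\<lambda>h. G x \<bullet> h)) (at x)"
    and G: "(G has_derivative G') (at q)"
  shows "partial_deriv a (partial_deriv b (graph_param v)) q = vector [0, 0, G' (axis a 1) $ b]"
proof -
  have eq: "partial_deriv b (graph_param v) x = vector [if b = 1 then 1 else 0, if b = 2 then 1 else 0, G x $ b]"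
    if "x \<in> S" for x
    using exhaust_2[of b] partial_deriv_graph_param[OF v[OF that]] by auto
  have "((\<lambda>x. (vector [if b = 1 then 1 else 0, if b = 2 then 1 else 0, G x $ b] :: real^3) $ i)
      has_derivative (\<lambda>h. (vector [0, 0, G' h $ b] :: real^3) $ i)) (at q)" for i
    using exhaust_3[of i] G by (auto intro: bounded_linear.has_derivative[OF bounded_linear_vec_nth])
  then have "((\<lambda>x. vector [if b = 1 then 1 else 0, if b = 2 then 1 else 0, G x $ b] :: real^3)
      has_derivative (\<lambda>h. vector [0, 0, G' h $ b])) (at q)"
    by (subst has_derivative_componentwise_within) (auto simp: Basis_vec_def inner_axis)
  then have "(partial_deriv b (graph_param v) has_derivative (\<lambda>h. vector [0, 0, G' h $ b])) (at q)"
    by (rule has_derivative_transform_within_open[OF _ assms(1,2)]) (simp add: eq)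
  then show ?thesis
    by (rule partial_deriv_eq)
qed

text \<open>
  Here \<open>(p, r)\<close> is the Euclidean gradient of the graph function, with \<open>x\<close>-derivative \<open>(pp, rp)\<close>
  and \<open>y\<close>-derivative \<open>(pr, rr)\<close>. The left
  side is the divergence of the flux times \<open>sqrt (1 - M (p\<^sup>2 + r\<^sup>2) / L)\<close>, the right side a multiple of
  the trace of the second fundamental form.
\<close>

lemma divergence_trace_identity:
  fixes L M D p r Lx Ly Mx My pp pr rp rr :: real
  assumes nz: "L \<noteq> 0" "M \<noteq> 0" "D \<noteq> 0" and D: "L = D + M * (p\<^sup>2 + r\<^sup>2)"
  shows "M * pp + (Mx - M * (- (Mx * (p * p + r * r) / L + 2 * M * (p * pp + r * rp) / L
        - M * (p * p + r * r) * Lx / L\<^sup>2) * L / (2 * D))) * p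
      + (M * rr + (My - M * (- (My * (p * p + r * r) / L + 2 * M * (p * pr + r * rr) / L
        - M * (p * p + r * r) * Ly / L\<^sup>2) * L / (2 * D))) * r)
    = - M * ((L - M * r\<^sup>2) * ((p * Lx - r * Ly + p\<^sup>2 * (p * Mx + r * My)) / (2 * L) - p * Mx / M - pp)
      + M * p * r * ((p * Ly + r * Lx + p * r * (p * Mx + r * My)) / (2 * L)
           - (p * My + r * Mx) / (2 * M) - rp
         + ((p * Ly + r * Lx + p * r * (p * Mx + r * My)) / (2 * L) - (p * My + r * Mx) / (2 * M) - pr))
      + (L - M * p\<^sup>2) * ((r * Ly - p * Lx + r\<^sup>2 * (p * Mx + r * My)) / (2 * L) - r * My / M - rr)) / D"
proof -
  \<comment> \<open>Passing to \<open>k = M / L\<close>, \<open>d = D / L\<close> and logarithmic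
    derivatives lets the powers of \<open>L\<close> factor out. What remains is polynomial apart
    from the denominator \<open>d\<close> and numerical constants.\<close>
  define k lx ly mx my d where "k = M / L" and "lx = Lx / L" and "ly = Ly / L"
    and "mx = Mx / M" and "my = My / M" and "d = D / L"
  then have subs: "M = k * L" "Lx = L * lx" "Ly = L * ly" "Mx = k * L * mx" "My = k * L * my" "D = L * d"
    using nz by auto
  have k: "k \<noteq> 0" and d: "d \<noteq> 0"
    using nz by (auto simp: k_def d_def)
  have d1: "1 = d + k * (p\<^sup>2 + r\<^sup>2)"
  proof -
    have "L * (d + k * (p\<^sup>2 + r\<^sup>2)) = L"
      using nz(1) D by (simp add: k_def d_def distrib_left)
    then show ?thesis
      using nz(1) by simp
  qed
  have x: "- (k * L * m * (p * p + r * r) / L + 2 * (k * L) * w / L - k * L * (p * p + r * r) * (L * l) / L\<^sup>2) * L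
      / (2 * (L * d)) = - (k * (m * (p * p + r * r) + 2 * w - (p * p + r * r) * l) / (2 * d))" for m w l
    using nz d by (simp add: field_simps power2_eq_square)
  have h: "(a * (L * lx) + b * (L * ly) + c * (p * (k * L * mx) + r * (k * L * my))) / (2 * L)
      = (a * lx + b * ly + k * c * (p * mx + r * my)) / 2" for a b c
    using nz by (simp add: field_simps)
  have h11: "(p * (L * lx) - r * (L * ly) + p\<^sup>2 * (p * (k * L * mx) + r * (k * L * my))) / (2 * L)
      - p * (k * L * mx) / (k * L) - pp = (p * lx - r * ly + k * p\<^sup>2 * (p * mx + r * my)) / 2 - p * mx - pp"
    using h[of p "- r" "p\<^sup>2"] nz k by simp
  have h22: "(r * (L * ly) - p * (L * lx) + r\<^sup>2 * (p * (k * L * mx) + r * (k * L * my))) / (2 * L)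
      - r * (k * L * my) / (k * L) - rr = (r * ly - p * lx + k * r\<^sup>2 * (p * mx + r * my)) / 2 - r * my - rr"
    using h[of "- p" r "r\<^sup>2"] nz k by simp
  have h12: "(p * (L * ly) + r * (L * lx) + p * r * (p * (k * L * mx) + r * (k * L * my))) / (2 * L)
      - (p * (k * L * my) + r * (k * L * mx)) / (2 * (k * L)) - w
      = (p * ly + r * lx + k * (p * r) * (p * mx + r * my) - p * my - r * mx) / 2 - w" for w
  proof -
    have "(p * (k * L * my) + r * (k * L * mx)) / (2 * (k * L)) = (p * my + r * mx) / 2"
      using nz k by (simp add: field_simps)
    then show ?thesis
      using h[of r p "p * r"] by (simp add: diff_divide_distrib add_divide_distrib)
  qed
  let ?E = "p * p + r * r"
  \<comment> \<open>Up to the factor \<open>k * L\<close>, \<open>U\<close> holds the terms of the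
    divergence in which the square root is not differentiated and \<open>V\<close> those in which it
    is. \<open>T\<close> is the trace expression divided by \<open>L\<close>.\<close>
  define U where "U = pp + rr + mx * p + my * r"
  define V where "V = (mx * ?E + 2 * (p * pp + r * rp) - ?E * lx) * p + (my * ?E + 2 * (p * pr + r * rr) - ?E * ly) * r"
  define T where "T = (1 - k * r\<^sup>2) * ((p * lx - r * ly + k * p\<^sup>2 * (p * mx + r * my)) / 2 - p * mx - pp)
      + k * p * r * ((p * ly + r * lx + k * (p * r) * (p * mx + r * my) - p * my - r * mx) / 2 - rp
         + ((p * ly + r * lx + k * (p * r) * (p * mx + r * my) - p * my - r * mx) / 2 - pr))
      + (1 - k * p\<^sup>2) * ((r * ly - p * lx + k * r\<^sup>2 * (p * mx + r * my)) / 2 - r * my - rr)"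
  have dd: "d = 1 - k * ?E"
    using d1 by (simp add: power2_eq_square)
  \<comment> \<open>This polynomial identity is the core of the computation; it needs the relation
    between \<open>d\<close> and \<open>k\<close>.\<close>
  have "2 * (U * d) + k * V + 2 * T = 0"
    unfolding U_def V_def T_def dd by (simp add: field_simps power2_eq_square)
  then have T: "T = - (U * d) - k * V / 2"
    by simp
  have main: "U + k * V / (2 * d) = - T / d"
    unfolding T using d by (simp add: field_simps)
  have "- (k * L) * (L * T) / (L * d) = (k * L) * (- T / d)"
    using nz by simp
  also have "\<dots> = (k * L) * (U + k * V / (2 * d))"
    by (simp only: main)
  finally have fin: "(k * L) * (U + k * V / (2 * d)) = - (k * L) * (L * T) / (L * d)" ..
  have lhs: "k * L * pp + (k * L * mx - k * L * - (k * a / (2 * d))) * p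
      + (k * L * rr + (k * L * my - k * L * - (k * b / (2 * d))) * r)
      = k * L * (pp + rr + mx * p + my * r + k * (a * p + b * r) / (2 * d))" for a b
    by (simp add: add_divide_distrib algebra_simps)
  have rhs: "(L - k * L * r\<^sup>2) * a + k * L * p * r * b + (L - k * L * p\<^sup>2) * c
      = L * ((1 - k * r\<^sup>2) * a + k * p * r * b + (1 - k * p\<^sup>2) * c)" for a b c
    by (simp add: algebra_simps)
  show ?thesis
    unfolding subs x h11 h22 h12 lhs rhs by (rule fin[unfolded U_def V_def T_def])
qed

text \<open>The geometry is computed at one point \<open>q\<close>. \<open>G\<close> is the
  Euclidean gradient of \<open>v\<close>, \<open>L'\<close> and \<open>M'\<close> are the
  differentials of the squares in the metric. Since
  \<open>\<nabla>v = G / \<lambda>\<^sup>2\<close>, the last assumption is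
  \<open>\<mu>\<^sup>2 |\<nabla>v|\<^sup>2 < 1\<close> at \<open>q\<close>.\<close>

locale graph_point =
  fixes lam mu :: "real^2 \<Rightarrow> real" and S :: "(real^2) set" and v :: "real^2 \<Rightarrow> real"
    and G :: "real^2 \<Rightarrow> real^2" and G' :: "real^2 \<Rightarrow> real^2" and L' M' :: "real^2 \<Rightarrow> real"
    and q :: "real^2"
  assumes S: "open S" "q \<in> S"
    and pos: "0 < lam q" "0 < mu q"
    and lam': "((\<lambda>x. (lam x)\<^sup>2) has_derivative L') (at q)"
    and mu': "((\<lambda>x. (mu x)\<^sup>2) has_derivative M') (at q)"
    and v': "\<And>x. x \<in> S \<Longrightarrow> (v has_derivative (\<lambda>h. G x \<bullet> h)) (at x)"
    and G': "(G has_derivative G') (at q)"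
    and spacelike: "(mu q)\<^sup>2 * (G q \<bullet> G q) < (lam q)\<^sup>2"
begin

abbreviation "g \<equiv> lorentz_warped_metric lam mu"
abbreviation "X \<equiv> graph_param v"
abbreviation "L \<equiv> (lam q)\<^sup>2"
abbreviation "M \<equiv> (mu q)\<^sup>2"
abbreviation "v1 \<equiv> G q $ 1"
abbreviation "v2 \<equiv> G q $ 2"

text \<open>The determinant of the induced metric is \<open>L * D\<close>.\<close>

definition D :: real where "D = L - M * (v1\<^sup>2 + v2\<^sup>2)"

text \<open>The ambient gradient of \<open>v - z\<close>, whose zero set is the graph, multiplied by
  \<open>L * M\<close> to clear denominators.\<close>

definition normal :: "real^3" where "normal = vector [M * v1, M * v2, L]"

lemma D_pos: "0 < D"
  using spacelike by (simp add: D_def inner_vec_def sum_2 power2_eq_square)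

lemma tangents:
  "partial_deriv 1 X q = vector [1, 0, v1]" "partial_deriv 2 X q = vector [0, 1, v2]"
  using partial_deriv_graph_param[OF v'[OF S(2)]] by auto

lemma induced_metric_graph:
  "induced_metric g X q $ 1 $ 1 = L - M * v1\<^sup>2" "induced_metric g X q $ 1 $ 2 = - M * v1 * v2"
  "induced_metric g X q $ 2 $ 1 = - M * v1 * v2" "induced_metric g X q $ 2 $ 2 = L - M * v2\<^sup>2"
  by (simp_all add: induced_metric_def metric_inner_lorentz tangents power2_eq_square)

lemma matrix_inv_induced:
  "matrix_inv (induced_metric g X q) = vector [vector [(L - M * v2\<^sup>2) / (L * D), M * v1 * v2 / (L * D)],
     vector [M * v1 * v2 / (L * D), (L - M * v1\<^sup>2) / (L * D)]]"
proof (rule matrix_inv_unique)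
  have "(L - M * v1\<^sup>2) * (L - M * v2\<^sup>2) - (M * v1 * v2) * (M * v1 * v2) = L * D"
    unfolding D_def by algebra
  moreover have "L * D \<noteq> 0"
    using D_pos pos by simp
  ultimately show "induced_metric g X q ** vector [vector [(L - M * v2\<^sup>2) / (L * D), M * v1 * v2 / (L * D)],
     vector [M * v1 * v2 / (L * D), (L - M * v1\<^sup>2) / (L * D)]] = mat 1"
    by (simp add: matrix_matrix_mult_def mat_def vec_eq_iff forall_2 sum_2 induced_metric_graph
        flip: add_divide_distrib diff_divide_distrib) (simp add: algebra_simps)
qed

text \<open>The normal space is spanned by \<open>normal\<close>. The coefficient is the quotient of
  the product of \<open>w\<close> with \<open>normal\<close>, which is \<open>L * M\<close> times
  the bracket, by the square \<open>- L * M * D\<close> of \<open>normal\<close>.\<close>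

lemma normal_part_graph: "normal_part g X q w = - ((v1 * w $ 1 + v2 * w $ 2 - w $ 3) / D) *\<^sub>R normal"
proof -
  have nz: "L \<noteq> 0" "D \<noteq> 0"
    using D_pos pos by auto
  have D: "L = D + M * (v1\<^sup>2 + v2\<^sup>2)"
    by (simp add: D_def)
  define a b where "a = L * w $ 1 - M * (w $ 3 * v1)" and "b = L * w $ 2 - M * (w $ 3 * v2)"
  \<comment> \<open>The coefficients of the tangential part of \<open>w\<close> with respect to the
    two coordinate tangent vectors.\<close>
  define c d where "c = (L - M * v2\<^sup>2) / (L * D) * a + M * v1 * v2 / (L * D) * b"
    and "d = M * v1 * v2 / (L * D) * a + (L - M * v1\<^sup>2) / (L * D) * b"
  have ab: "metric_inner g (X q) w (partial_deriv 1 X q) = a" "metric_inner g (X q) w (partial_deriv 2 X q) = b"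
    by (simp_all add: metric_inner_lorentz tangents a_def b_def algebra_simps)
  have "normal_part g X q w = w - vector [c, d, c * v1 + d * v2]"
    unfolding normal_part_def
    by (simp only: matrix_inv_induced sum_2 ab vector_2 c_def d_def)
      (simp add: tangents vec_eq_iff forall_3 algebra_simps)
  moreover have c: "c = w $ 1 + (v1 * w $ 1 + v2 * w $ 2 - w $ 3) * M * v1 / D"
  proof -
    have "(L - M * v2\<^sup>2) * a + M * v1 * v2 * b
        = L * (D * w $ 1 + (v1 * w $ 1 + v2 * w $ 2 - w $ 3) * M * v1)"
      unfolding a_def b_def D_def by algebra
    then show ?thesis
      using nz by (simp add: c_def add_divide_distrib[symmetric] nonzero_divide_eq_eq) (simp add: field_simps)
  qed
  moreover have d: "d = w $ 2 + (v1 * w $ 1 + v2 * w $ 2 - w $ 3) * M * v2 / D"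
  proof -
    have "M * v1 * v2 * a + (L - M * v1\<^sup>2) * b
        = L * (D * w $ 2 + (v1 * w $ 1 + v2 * w $ 2 - w $ 3) * M * v2)"
      unfolding a_def b_def D_def by algebra
    then show ?thesis
      using nz by (simp add: d_def add_divide_distrib[symmetric] nonzero_divide_eq_eq) (simp add: field_simps)
  qed
  moreover have "w $ 3 - (c * v1 + d * v2) = - (v1 * w $ 1 + v2 * w $ 2 - w $ 3) * L / D"
    unfolding c d using nz(2) D by (simp add: divide_simps) (simp add: algebra_simps power2_eq_square)
  moreover have "(w $ 3 - (v1 * w $ 1 + v2 * w $ 2)) * L / D
      = - ((v1 * w $ 1 + v2 * w $ 2 - w $ 3) * L / D)"
    by (simp add: algebra_simps minus_divide_left)
  ultimately show ?thesis
    by (simp add: normal_def vec_eq_iff forall_3)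
qed

text \<open>\<open>normal\<close> has square \<open>- L * M * D\<close>, and its product with the
  vertical direction is \<open>- L * M\<close>, which fixes the sign.\<close>

lemma upward_unit_normal_graph: "upward_unit_normal g X q ((1 / (lam q * mu q * sqrt D)) *\<^sub>R normal)"
proof -
  have "L * ((M * v1)\<^sup>2 + (M * v2)\<^sup>2) - M * L\<^sup>2 = - (L * M * D)"
    unfolding D_def by algebra
  moreover have scale: "metric_inner g (X q) (k *\<^sub>R normal) (k *\<^sub>R normal)
      = k\<^sup>2 * (L * ((M * v1)\<^sup>2 + (M * v2)\<^sup>2) - M * L\<^sup>2)" for k
    by (simp add: metric_inner_lorentz normal_def) algebra
  moreover have "(1 / (lam q * mu q * sqrt D))\<^sup>2 * (L * M * D) = 1"
    using D_pos pos by (simp add: power_divide power_mult_distrib)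
  ultimately have "metric_inner g (X q) ((1 / (lam q * mu q * sqrt D)) *\<^sub>R normal)
      ((1 / (lam q * mu q * sqrt D)) *\<^sub>R normal) = - 1"
    by (metis mult_minus_right)
  moreover have "metric_inner g (X q) ((1 / (lam q * mu q * sqrt D)) *\<^sub>R normal) (axis 3 1) < 0"
    using pos D_pos by (simp add: metric_inner_lorentz normal_def axis_def)
  moreover have "metric_inner g (X q) ((1 / (lam q * mu q * sqrt D)) *\<^sub>R normal) (partial_deriv a X q) = 0" for a
    using exhaust_2[of a] by (auto simp: metric_inner_lorentz normal_def tangents)
  ultimately show ?thesis
    by (simp add: upward_unit_normal_def)
qed

text \<open>The product of \<open>ambient_covariant\<close> and \<open>normal\<close>, divided by \<open>L * M\<close>.\<close>

definition height :: "2 \<Rightarrow> 2 \<Rightarrow> real" where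
  "height a b = v1 * ambient_covariant g X q a b $ 1 + v2 * ambient_covariant g X q a b $ 2
     - ambient_covariant g X q a b $ 3"

text \<open>The denominator combines \<open>L * D\<close> from the inverse induced metric,
  \<open>D\<close> from the normal projection and \<open>2\<close> from the average.\<close>

lemma mean_curvature_vector_graph:
  "mean_curvature_vector g X q = - (((L - M * v2\<^sup>2) * height 1 1 + M * v1 * v2 * (height 1 2 + height 2 1)
      + (L - M * v1\<^sup>2) * height 2 2) / (2 * L * D\<^sup>2)) *\<^sub>R normal"
proof -
  have "second_fundamental_form g X q a b = - (height a b / D) *\<^sub>R normal" for a b
    by (simp add: second_fundamental_form_def normal_part_graph height_def)
  then show ?thesis
    using pos D_pos
    by (simp add: mean_curvature_vector_def matrix_inv_induced sum_2 vec_eq_iff)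
      (simp add: power2_eq_square field_simps)
qed

lemma ambient:
  "ambient_covariant g X q a b $ k = (if k = 3 then G' (axis a 1) $ b else 0)
     + (\<Sum>i\<in>UNIV. \<Sum>j\<in>UNIV. christoffel g (X q) k i j * partial_deriv a X q $ i * partial_deriv b X q $ j)"
  using exhaust_3[of k] partial_deriv_partial_deriv_graph_param[OF S v' G']
  by (auto simp: ambient_covariant_def)

lemma height_graph:
  defines "e1 \<equiv> axis 1 1" and "e2 \<equiv> axis 2 1"
  shows "height 1 1 = (v1 * L' e1 - v2 * L' e2 + v1\<^sup>2 * (v1 * M' e1 + v2 * M' e2)) / (2 * L)
      - v1 * M' e1 / M - G' e1 $ 1"
    and "height 1 2 = (v1 * L' e2 + v2 * L' e1 + v1 * v2 * (v1 * M' e1 + v2 * M' e2)) / (2 * L)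
      - (v1 * M' e2 + v2 * M' e1) / (2 * M) - G' e1 $ 2"
    and "height 2 1 = (v1 * L' e2 + v2 * L' e1 + v1 * v2 * (v1 * M' e1 + v2 * M' e2)) / (2 * L)
      - (v1 * M' e2 + v2 * M' e1) / (2 * M) - G' e2 $ 1"
    and "height 2 2 = (v2 * L' e2 - v1 * L' e1 + v2\<^sup>2 * (v1 * M' e1 + v2 * M' e2)) / (2 * L)
      - v2 * M' e2 / M - G' e2 $ 2"
proof -
  \<comment> \<open>These are the derivatives of the metric coefficients in the direction of
    \<open>z\<close>.\<close>
  have [simp]: "L' 0 = 0" "M' 0 = 0"
    using lam' mu' by (auto dest: has_derivative_linear linear_0)
  have chr: "christoffel g (X q) k i j = (1/2) * inverse (if k = 3 then - M else L) *
     ((if j \<noteq> k then 0 else if j = 3 then - M' (base_point (axis i 1)) else L' (base_point (axis i 1)))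
      + (if i \<noteq> k then 0 else if i = 3 then - M' (base_point (axis j 1)) else L' (base_point (axis j 1)))
      - (if i \<noteq> j then 0 else if i = 3 then - M' (base_point (axis k 1)) else L' (base_point (axis k 1))))"
    for k i j
    using christoffel_lorentz[where lam = lam and mu = mu and x = "X q" and k = k and i = i and j = j, of L' M'] lam' mu' pos by simp
  note s = height_def ambient chr tangents sum_3
  show "height 1 1 = (v1 * L' e1 - v2 * L' e2 + v1\<^sup>2 * (v1 * M' e1 + v2 * M' e2)) / (2 * L)
      - v1 * M' e1 / M - G' e1 $ 1"
    unfolding e1_def e2_def using pos by (simp add: s field_simps power2_eq_square)
  show "height 1 2 = (v1 * L' e2 + v2 * L' e1 + v1 * v2 * (v1 * M' e1 + v2 * M' e2)) / (2 * L)
      - (v1 * M' e2 + v2 * M' e1) / (2 * M) - G' e1 $ 2"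
    unfolding e1_def e2_def using pos by (simp add: s field_simps power2_eq_square)
  show "height 2 1 = (v1 * L' e2 + v2 * L' e1 + v1 * v2 * (v1 * M' e1 + v2 * M' e2)) / (2 * L)
      - (v1 * M' e2 + v2 * M' e1) / (2 * M) - G' e2 $ 1"
    unfolding e1_def e2_def using pos by (simp add: s field_simps power2_eq_square)
  show "height 2 2 = (v2 * L' e2 - v1 * L' e1 + v2\<^sup>2 * (v1 * M' e1 + v2 * M' e2)) / (2 * L)
      - v2 * M' e2 / M - G' e2 $ 2"
    unfolding e1_def e2_def using pos by (simp add: s field_simps power2_eq_square)
qed

text \<open>The induced form is \<open>L * (u \<bullet> u) - M * (G q \<bullet> u)\<^sup>2\<close>,
  and Cauchy-Schwarz bounds the negative term.\<close>

lemma metric_inner_induced_pos: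
  assumes "u \<noteq> 0"
  shows "0 < metric_inner (induced_metric g X) q u u"
proof -
  have u: "0 < u \<bullet> u"
    using assms by simp
  have "M * (G q \<bullet> u)\<^sup>2 \<le> M * ((G q \<bullet> G q) * (u \<bullet> u))"
    by (intro mult_left_mono Cauchy_Schwarz_ineq) simp
  also have "\<dots> = (M * (G q \<bullet> G q)) * (u \<bullet> u)"
    by simp
  also have "\<dots> < L * (u \<bullet> u)"
    using spacelike u by (intro mult_strict_right_mono)
  finally have "0 < L * (u \<bullet> u) - M * (G q \<bullet> u)\<^sup>2"
    by simp
  also have "\<dots> = metric_inner (induced_metric g X) q u u"
    unfolding metric_inner_def inner_vec_def sum_2 induced_metric_graph by (simp add: power2_eq_square algebra_simps)
  finally show ?thesis .
qed

text \<open>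
  The equation \<open>H = div (\<mu>\<^sup>2 \<nabla>v / sqrt (1 - \<mu>\<^sup>2 |\<nabla>v|\<^sup>2)) / (2 \<mu>)\<close> in coordinates, where \<open>\<nabla>v = G / \<lambda>\<^sup>2\<close> and
  \<open>div Y\<close> is \<open>1 / \<lambda>\<^sup>2\<close> times the Euclidean divergence of \<open>\<lambda>\<^sup>2 Y\<close>.
\<close>

lemma mean_curvature_graph:
  assumes flux: "((\<lambda>x. ((mu x)\<^sup>2 / sqrt (1 - (mu x)\<^sup>2 * (G x \<bullet> G x) / (lam x)\<^sup>2)) *\<^sub>R G x)
      has_derivative F') (at q)"
    and div: "F' (axis 1 1) $ 1 + F' (axis 2 1) $ 2 = 2 * mu q * (lam q)\<^sup>2 * H"
  shows "\<exists>N. upward_unit_normal g X q N \<and> mean_curvature_vector g X q = H *\<^sub>R N"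
proof -
  let ?E = "G q \<bullet> G q"
  define s where "s = sqrt (1 - M * ?E / L)"
  have s2: "s\<^sup>2 = D / L" and s: "0 < s"
    using pos D_pos spacelike
    by (simp_all add: s_def D_def inner_vec_def sum_2 power2_eq_square divide_simps)
  have E': "((\<lambda>x. G x \<bullet> G x) has_derivative (\<lambda>h. 2 * (G q \<bullet> G' h))) (at q)"
    using has_derivative_inner[OF G' G'] by (simp add: inner_commute)
  define S' where "S' h = - (M' h * ?E / L + 2 * M * (G q \<bullet> G' h) / L - M * ?E * L' h / L\<^sup>2) / (2 * s)" for h
  have arg': "((\<lambda>x. 1 - (mu x)\<^sup>2 * (G x \<bullet> G x) / (lam x)\<^sup>2) has_derivative (\<lambda>h. S' h * (2 * s))) (at q)"
    by (rule has_derivative_eq_rhs[OF has_derivative_diff[OF has_derivative_const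
            has_derivative_divide'[OF has_derivative_mult[OF mu' E'] lam']]])
      (use pos s in \<open>auto simp: S'_def fun_eq_iff field_simps power2_eq_square\<close>)
  have arg_pos: "0 < 1 - M * ?E / L"
    using s by (simp add: s_def)
  have s': "((\<lambda>x. sqrt (1 - (mu x)\<^sup>2 * (G x \<bullet> G x) / (lam x)\<^sup>2)) has_derivative S') (at q)"
    by (rule has_derivative_eq_rhs[OF has_derivative_real_sqrt[OF _ arg']])
      (simp_all only: s_def[symmetric] arg_pos, use s in simp)
  have "((\<lambda>x. ((mu x)\<^sup>2 / sqrt (1 - (mu x)\<^sup>2 * (G x \<bullet> G x) / (lam x)\<^sup>2)) *\<^sub>R G x)
      has_derivative (\<lambda>h. (M / s) *\<^sub>R G' h + ((M' h * s - M * S' h) / (s * s)) *\<^sub>R G q)) (at q)"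
    by (rule has_derivative_eq_rhs[OF has_derivative_scaleR[OF has_derivative_divide'[OF mu' s'] G']])
      (use s in \<open>simp_all flip: s_def\<close>)
  \<comment> \<open>The given derivative of the flux must agree with the one from the product and
    quotient rules.\<close>
  from has_derivative_unique[OF flux this]
  have F': "F' h $ i = M / s * G' h $ i + (M' h * s - M * S' h) / (s * s) * G q $ i" for h i
    by simp
  define e1 e2 :: "real^2" where "e1 = axis 1 1" and "e2 = axis 2 1"
  define T where "T = (L - M * v2\<^sup>2) * height 1 1 + M * v1 * v2 * (height 1 2 + height 2 1)
      + (L - M * v1\<^sup>2) * height 2 2"
  \<comment> \<open>Dividing by \<open>s\<close> once more produces
    \<open>s\<^sup>2 = D / L\<close>, so the square root disappears and the algebraic identity
    applies.\<close>
  have S'_s: "S' h / s = - (M' h * ?E / L + 2 * M * (G q \<bullet> G' h) / L - M * ?E * L' h / L\<^sup>2) * L / (2 * D)" for h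
  proof -
    have "S' h / s = - (M' h * ?E / L + 2 * M * (G q \<bullet> G' h) / L - M * ?E * L' h / L\<^sup>2) / (2 * s\<^sup>2)"
      by (simp add: S'_def power2_eq_square)
    then show ?thesis
      by (simp add: s2)
  qed
  have "F' h $ i * s = M * G' h $ i + (M' h - M * (S' h / s)) * G q $ i" for h i
    using s by (simp add: F' field_simps)
  then have "(F' e1 $ 1 + F' e2 $ 2) * s
      = M * G' e1 $ 1 + (M' e1 - M * (S' e1 / s)) * v1 + (M * G' e2 $ 2 + (M' e2 - M * (S' e2 / s)) * v2)"
    by (simp add: distrib_right)
  also have "\<dots> = - M * T / D"
    unfolding T_def height_graph e1_def[symmetric] e2_def[symmetric] S'_s inner_vec_def sum_2 inner_real_def
    by (rule divergence_trace_identity) (use pos D_pos in \<open>auto simp: D_def\<close>)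
  finally have "(F' e1 $ 1 + F' e2 $ 2) * s = - M * T / D" .
  \<comment> \<open>The divergence equation, solved for the trace. With
    \<open>sqrt D = lam q * s\<close> the coefficient of \<open>normal\<close> becomes
    \<open>H\<close> over the normalising factor.\<close>
  then have T: "T = - (2 * mu q * L * H) * s * D / M"
    using D_pos pos div by (simp add: e1_def e2_def field_simps)
  have sqrt_D: "sqrt D = lam q * s"
    using s2 s pos D_pos by (intro real_sqrt_unique) (simp_all add: power_mult_distrib)
  have "D = L * s\<^sup>2"
    using s2 pos by (simp add: field_simps)
  then have "- (T / (2 * L * D\<^sup>2)) = H * (1 / (lam q * mu q * sqrt D))"
    unfolding T sqrt_D using pos s by (simp add: field_simps power2_eq_square)
  then show ?thesis
    using upward_unit_normal_graph mean_curvature_vector_graph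
    by (intro exI[of _ "(1 / (lam q * mu q * sqrt D)) *\<^sub>R normal"]) (simp add: T_def)
qed

end

section \<open>Graphs over domains with symmetric data\<close>

lemma has_derivative_cong_open:
  assumes "open S" "x \<in> S" "(f has_derivative f') (at x)" "\<And>y. y \<in> S \<Longrightarrow> g y = f y"
  shows "(g has_derivative f') (at x)"
  by (rule has_derivative_transform_within_open[OF assms(3,1,2)]) (simp add: assms(4))

text \<open>
  \<open>rel\<close> relates points in the same orbit of the symmetry group; \<open>derivative_radial\<close> says that the
  gradient of an invariant function is parallel to \<open>Q (x - c)\<close>, multiplied by \<open>|Q (x - c)|\<^sup>2\<close> because
  on a strip this direction is lost where \<open>Q (x - c)\<close> vanishes.
\<close>

locale symmetric_domain =
  fixes S :: "(real^2) set" and c :: "real^2" and Q :: "real^2 \<Rightarrow> real^2" and m :: nat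
    and rel :: "real^2 \<Rightarrow> real^2 \<Rightarrow> bool"
  assumes open_S: "open S" and convex_S: "convex S" and center: "c \<in> S"
    and linear_Q: "linear Q" and Q_sym: "\<And>x y. Q x \<bullet> y = x \<bullet> Q y" and Q_idem: "\<And>x. Q (Q x) = Q x"
    and trace_Q: "Q (axis 1 1) $ 1 + Q (axis 2 1) $ 2 = real (Suc m)"
    and rel_norm: "\<And>x y. rel x y \<Longrightarrow> Q (x - c) \<bullet> Q (x - c) = Q (y - c) \<bullet> Q (y - c)"
    and rel_ray: "\<And>x y t. rel x y \<Longrightarrow> 0 \<le> t \<Longrightarrow> t \<le> 1 \<Longrightarrow>
      rel (c + t *\<^sub>R (x - c)) (c + t *\<^sub>R (y - c))"
    and derivative_Q: "\<And>f f' x h. \<forall>x\<in>S. \<forall>y\<in>S. rel x y \<longrightarrow> f x = (f y :: real) \<Longrightarrow> x \<in> S \<Longrightarrow>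
      (f has_derivative f') (at x) \<Longrightarrow> f' (Q h) = f' h"
    and derivative_radial: "\<And>f f' x h. \<forall>x\<in>S. \<forall>y\<in>S. rel x y \<longrightarrow> f x = (f y :: real) \<Longrightarrow> x \<in> S \<Longrightarrow>
      (f has_derivative f') (at x) \<Longrightarrow>
      (Q (x - c) \<bullet> Q (x - c)) * f' h = f' (x - c) * (Q (x - c) \<bullet> h)"
begin

section \<open>Invariant functions: divergence and potential\<close>

definition invariant :: "(real^2 \<Rightarrow> real) \<Rightarrow> bool" where
  "invariant f \<longleftrightarrow> (\<forall>x\<in>S. \<forall>y\<in>S. rel x y \<longrightarrow> f x = f y)"

text \<open>Related points stay related when contracted towards \<open>c\<close>, so the integrands
  agree for each \<open>t\<close>.\<close>

lemma invariant_ray_average: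
  assumes "invariant f"
  shows "invariant (ray_average c n f)"
  unfolding invariant_def ray_average_def
proof (intro ballI impI integral_cong)
  fix x y t assume "x \<in> S" "y \<in> S" "rel x y" "t \<in> {0..1::real}"
  then have "f (c + t *\<^sub>R (x - c)) = f (c + t *\<^sub>R (y - c))"
    using assms ray_in[OF convex_S center] rel_ray unfolding invariant_def by simp
  then show "t ^ n * f (c + t *\<^sub>R (x - c)) = t ^ n * f (c + t *\<^sub>R (y - c))"
    by simp
qed

abbreviation Z :: "real^2 \<Rightarrow> real^2" where "Z x \<equiv> Q (x - c)"
abbreviation \<rho> :: "real^2 \<Rightarrow> real" where "\<rho> x \<equiv> Z x \<bullet> Z x"

lemma Z_has_derivative: "(Z has_derivative Q) (at x)"
proof -
  have "bounded_linear Q"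
    using linear_Q by (rule linear_conv_bounded_linear[THEN iffD1])
  then have "((\<lambda>x. Q x - Q c) has_derivative (\<lambda>h. Q h - 0)) (at x)"
    by (intro has_derivative_diff has_derivative_const bounded_linear_imp_has_derivative)
  then show ?thesis
    by (simp add: linear_diff[OF linear_Q])
qed

lemma \<rho>_has_derivative: "(\<rho> has_derivative (\<lambda>h. 2 * (Z x \<bullet> h))) (at x)"
  by (rule has_derivative_eq_rhs[OF has_derivative_inner[OF Z_has_derivative Z_has_derivative]])
    (simp add: fun_eq_iff Q_sym Q_idem inner_commute)

lemma Ck_on_\<rho>: "Ck_on k S \<rho>"
proof (cases k)
  case 0
  then show ?thesis
    by (simp add: continuous_at_imp_continuous_on has_derivative_continuous[OF \<rho>_has_derivative])
next
  case (Suc n)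
  have "Ck_on n S (\<lambda>x. 2 * (Z x \<bullet> h))" for h
  proof -
    have eq: "(\<lambda>x. 2 * (Z x \<bullet> h)) = (\<lambda>x. 2 * (x \<bullet> Q h) + - 2 * (c \<bullet> Q h))"
      by (simp add: Q_sym inner_diff_left fun_eq_iff)
    show ?thesis
      unfolding eq
      by (rule Ck_on_add[OF open_S Ck_on_bounded_linear[OF _ open_S] Ck_on_const])
        (rule bounded_linear_const_mult[OF bounded_linear_inner_left])
  qed
  then show ?thesis
    unfolding Suc by (rule Ck_on_SucI[OF open_S \<rho>_has_derivative])
qed

text \<open>The divergence of \<open>P Z\<close> is \<open>P\<close> times the trace
  \<open>Suc m\<close> of \<open>Q\<close>, plus the derivative of \<open>P\<close> along
  \<open>Z\<close>. By invariance the latter is the derivative along \<open>x - c\<close>, which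
  equals \<open>f x - Suc m * P x\<close>; the terms with \<open>P\<close> cancel.\<close>

lemma divergence_ray_average:
  assumes "invariant f" "Ck_on 1 S f" "x \<in> S"
  obtains F where "((\<lambda>y. ray_average c m f y *\<^sub>R Z y) has_derivative F) (at x)"
    "F (axis 1 1) $ 1 + F (axis 2 1) $ 2 = f x"
proof
  let ?P = "ray_average c m f"
  define P' where "P' w = ray_average c (Suc m) (\<lambda>y. frechet_derivative f (at y) w) x" for w
  have P': "(?P has_derivative P') (at x)"
    unfolding P'_def by (rule ray_average_has_derivative[OF open_S convex_S center assms(2,3)])
  show "((\<lambda>y. ?P y *\<^sub>R Z y) has_derivative (\<lambda>h. ?P x *\<^sub>R Q h + P' h *\<^sub>R Z x)) (at x)"
    by (rule has_derivative_scaleR[OF P' Z_has_derivative])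
  have "P' (Z x) = P' (x - c)"
    using derivative_Q[OF _ assms(3) P'] invariant_ray_average[OF assms(1)] unfolding invariant_def by blast
  also have "\<dots> = f x - Suc m * ?P x"
    unfolding P'_def by (rule ray_average_radial_derivative[OF open_S convex_S center assms(2,3)])
  finally have PZ: "P' (Z x) = f x - Suc m * ?P x" .
  have "Z x = Z x $ 1 *\<^sub>R axis 1 1 + Z x $ 2 *\<^sub>R axis 2 1"
    by (simp add: vec_eq_iff forall_2 axis_def)
  then have "P' (Z x) = Z x $ 1 * P' (axis 1 1) + Z x $ 2 * P' (axis 2 1)"
    using linear_add[OF has_derivative_linear[OF P']] linear_scale[OF has_derivative_linear[OF P']]
    by (metis real_scaleR_def)
  then have "P' (axis 1 1) * Z x $ 1 + P' (axis 2 1) * Z x $ 2 = f x - Suc m * ?P x"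
    using PZ by (simp add: mult.commute)
  moreover have "?P x * Q (axis 1 1) $ 1 + ?P x * Q (axis 2 1) $ 2 = Suc m * ?P x"
    by (simp only: trace_Q flip: distrib_left) simp
  ultimately show "(?P x *\<^sub>R Q (axis 1 1) + P' (axis 1 1) *\<^sub>R Z x) $ 1
      + (?P x *\<^sub>R Q (axis 2 1) + P' (axis 2 1) *\<^sub>R Z x) $ 2 = f x"
    by simp
qed

text \<open>Differentiating \<open>\<rho>\<close> gives \<open>2 * P\<close> times \<open>Z\<close>,
  and by \<open>derivative_radial\<close> differentiating \<open>P\<close> gives
  \<open>f x - 2 * P\<close> times \<open>Z\<close>. The weight exponent is 1, whatever
  \<open>m\<close> is, because \<open>\<rho>\<close> is quadratic.\<close>

lemma potential_has_derivative:
  assumes "invariant f" "Ck_on 1 S f" "x \<in> S"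
  shows "((\<lambda>y. \<rho> y * ray_average c 1 f y) has_derivative (\<lambda>h. (f x *\<^sub>R Z x) \<bullet> h)) (at x)"
proof -
  let ?P = "ray_average c 1 f"
  define P' where "P' w = ray_average c (Suc 1) (\<lambda>y. frechet_derivative f (at y) w) x" for w
  have P': "(?P has_derivative P') (at x)"
    unfolding P'_def by (rule ray_average_has_derivative[OF open_S convex_S center assms(2,3)])
  have "\<rho> x * P' h = P' (x - c) * (Z x \<bullet> h)" for h
    using derivative_radial[OF _ assms(3) P'] invariant_ray_average[OF assms(1)] unfolding invariant_def by blast
  moreover have "P' (x - c) = f x - Suc 1 * ?P x"
    unfolding P'_def by (rule ray_average_radial_derivative[OF open_S convex_S center assms(2,3)])
  ultimately have "\<rho> x * P' h + 2 * (Z x \<bullet> h) * ?P x = (f x *\<^sub>R Z x) \<bullet> h" for h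
    by (simp add: algebra_simps)
  with has_derivative_mult[OF \<rho>_has_derivative[of x] P'] show ?thesis
    by simp
qed

lemma admits_entire_spacelike_graph:
  assumes smooth: "smooth_on S lam" "smooth_on S mu" "smooth_on S H"
    and pos: "\<And>x. x \<in> S \<Longrightarrow> 0 < lam x" "\<And>x. x \<in> S \<Longrightarrow> 0 < mu x"
    and inv: "invariant lam" "invariant mu" "invariant H"
  shows "admits_entire_spacelike_graph S lam mu H"
proof -
  note ck = smooth[unfolded smooth_on_def, rule_format]
  define K where "K x = 2 * (mu x * (lam x * (lam x * H x)))" for x
  define P where "P = ray_average c m K"
  \<comment> \<open>The first summand keeps \<open>A\<close> positive even where
    \<open>\<rho>\<close> or \<open>P\<close> vanishes. In \<open>W\<close> the denominator
    \<open>mu x * sqrt (A x)\<close> is written as a single root so that smoothness follows from the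
    rule for inverse roots.\<close>
  define A where "A x = mu x * lam x * (mu x * lam x) + \<rho> x * (P x * P x)" for x
  define W where "W x = lam x * P x * inverse (sqrt (mu x * mu x * A x))" for x
  define v where "v x = \<rho> x * ray_average c 1 W x" for x
  define G where "G x = W x *\<^sub>R Z x" for x
  have K: "Ck_on k S K" "invariant K" for k
    unfolding K_def using inv
    by (auto intro!: Ck_on_mult open_S Ck_on_const ck simp: invariant_def)
  have P: "Ck_on k S P" "invariant P" for k
    unfolding P_def using K Ck_on_ray_average[OF open_S convex_S center] invariant_ray_average by auto
  have A_pos: "0 < A x" if "x \<in> S" for x
    unfolding A_def using pos[OF that] by (intro add_pos_nonneg) auto
  have "Ck_on k S A" for k
    unfolding A_def[abs_def] by (intro Ck_on_mult Ck_on_add open_S ck P Ck_on_\<rho>)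
  then have W: "Ck_on k S W" for k
    unfolding W_def[abs_def]
    by (intro Ck_on_mult Ck_on_inverse_sqrt open_S ck P) (simp_all add: A_pos pos)
  have inv_W: "invariant W"
    unfolding invariant_def
  proof (intro ballI impI)
    fix x y assume "x \<in> S" "y \<in> S" "rel x y"
    with inv P(2) have "lam x = lam y" "mu x = mu y" "P x = P y"
      unfolding invariant_def by blast+
    with rel_norm[OF \<open>rel x y\<close>] show "W x = W y"
      by (simp add: W_def A_def)
  qed
  have v: "Ck_on k S v" for k
    unfolding v_def[abs_def] by (intro Ck_on_mult Ck_on_\<rho> Ck_on_ray_average W open_S convex_S center)
  have v': "(v has_derivative (\<lambda>h. G x \<bullet> h)) (at x)" if "x \<in> S" for x
    unfolding v_def[abs_def] G_def by (rule potential_has_derivative[OF inv_W W that])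
  have GG: "(mu x)\<^sup>2 * (G x \<bullet> G x) / (lam x)\<^sup>2 = \<rho> x * (P x)\<^sup>2 / A x" if "x \<in> S" for x
  proof -
    have "(W x)\<^sup>2 = (lam x)\<^sup>2 * (P x)\<^sup>2 / ((mu x)\<^sup>2 * A x)"
      unfolding W_def using A_pos[OF that] pos[OF that]
      by (simp add: power_mult_distrib power_inverse divide_inverse flip: power2_eq_square)
    moreover have "G x \<bullet> G x = (W x)\<^sup>2 * \<rho> x"
      by (simp add: G_def power2_eq_square)
    ultimately show ?thesis
      using pos[OF that] by simp
  qed
  \<comment> \<open>This quantity is positive whatever \<open>P\<close> is, which makes the graph
    spacelike. Its square root \<open>mu x * lam x / sqrt (A x)\<close> then cancels against
    \<open>W\<close> in the flux, leaving \<open>P x *\<^sub>R Z x\<close>.\<close>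
  have deficit: "1 - (mu x)\<^sup>2 * (G x \<bullet> G x) / (lam x)\<^sup>2 = (mu x * lam x)\<^sup>2 / A x" if "x \<in> S" for x
    unfolding GG[OF that] using A_pos[OF that]
    by (simp add: field_simps) (simp add: A_def power2_eq_square)
  have flux: "((mu x)\<^sup>2 / sqrt (1 - (mu x)\<^sup>2 * (G x \<bullet> G x) / (lam x)\<^sup>2)) *\<^sub>R G x = P x *\<^sub>R Z x"
    if "x \<in> S" for x
  proof -
    have "sqrt (1 - (mu x)\<^sup>2 * (G x \<bullet> G x) / (lam x)\<^sup>2) = mu x * lam x / sqrt (A x)"
      unfolding deficit[OF that] using pos[OF that] by (simp add: real_sqrt_divide)
    moreover have "W x = lam x * P x / (mu x * sqrt (A x))"
      unfolding W_def using pos[OF that] by (simp add: real_sqrt_mult divide_inverse)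
    ultimately show ?thesis
      using pos[OF that] A_pos[OF that] by (simp add: G_def power2_eq_square)
  qed
  have point: "graph_point lam mu S v G
      (\<lambda>h. W x *\<^sub>R Q h + frechet_derivative W (at x) h *\<^sub>R Z x)
      (\<lambda>h. 2 * lam x * frechet_derivative lam (at x) h) (\<lambda>h. 2 * mu x * frechet_derivative mu (at x) h) x"
    if "x \<in> S" for x
  proof
    show "((\<lambda>x. (lam x)\<^sup>2) has_derivative (\<lambda>h. 2 * lam x * frechet_derivative lam (at x) h)) (at x)"
      using Ck_on_has_derivative[OF ck(1) that] by (auto intro!: derivative_eq_intros)
    show "((\<lambda>x. (mu x)\<^sup>2) has_derivative (\<lambda>h. 2 * mu x * frechet_derivative mu (at x) h)) (at x)"
      using Ck_on_has_derivative[OF ck(2) that] by (auto intro!: derivative_eq_intros)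
    show "(G has_derivative (\<lambda>h. W x *\<^sub>R Q h + frechet_derivative W (at x) h *\<^sub>R Z x)) (at x)"
      unfolding G_def[abs_def]
      by (rule has_derivative_scaleR[OF Ck_on_has_derivative[OF W that] Z_has_derivative])
    have "0 < 1 - (mu x)\<^sup>2 * (G x \<bullet> G x) / (lam x)\<^sup>2"
      unfolding deficit[OF that] using pos[OF that] A_pos[OF that] by simp
    then show "(mu x)\<^sup>2 * (G x \<bullet> G x) < (lam x)\<^sup>2"
      using pos[OF that] by (simp add: field_simps)
  qed (use open_S that pos v' in auto)
  have "spacelike_on (lorentz_warped_metric lam mu) S (graph_param v)"
    unfolding spacelike_on_def by (intro ballI allI impI graph_point.metric_inner_induced_pos[OF point])
  moreover have "prescribed_mean_curvature (lorentz_warped_metric lam mu) S (graph_param v) H"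
    unfolding prescribed_mean_curvature_def
  proof
    fix x assume x: "x \<in> S"
    obtain F where F: "((\<lambda>y. P y *\<^sub>R Z y) has_derivative F) (at x)"
      and div: "F (axis 1 1) $ 1 + F (axis 2 1) $ 2 = K x"
      unfolding P_def by (rule divergence_ray_average[OF K(2) K(1) x])
    show "\<exists>N. upward_unit_normal (lorentz_warped_metric lam mu) (graph_param v) x N \<and>
        mean_curvature_vector (lorentz_warped_metric lam mu) (graph_param v) x = H x *\<^sub>R N"
    proof (rule graph_point.mean_curvature_graph[OF point[OF x]])
      show "((\<lambda>x. ((mu x)\<^sup>2 / sqrt (1 - (mu x)\<^sup>2 * (G x \<bullet> G x) / (lam x)\<^sup>2)) *\<^sub>R G x) has_derivative F) (at x)"
        by (rule has_derivative_cong_open[OF open_S x F flux])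
      show "F (axis 1 1) $ 1 + F (axis 2 1) $ 2 = 2 * mu x * (lam x)\<^sup>2 * H x"
        by (simp add: div K_def power2_eq_square)
    qed
  qed
  ultimately show ?thesis
    unfolding admits_entire_spacelike_graph_def smooth_on_def using v by blast
qed

end

section \<open>Disks and strips\<close>

text \<open>Applied to orbits of the symmetry group: circles about the origin and lines along the
  strip.\<close>

lemma derivative_along_level_curve:
  fixes f :: "'a::real_normed_vector \<Rightarrow> real"
  assumes f': "(f has_derivative f') (at (g 0))" and g': "(g has_vector_derivative w) (at 0)"
    and const: "\<And>t::real. f (g t) = f (g 0)"
  shows "f' w = 0"
proof -
  have "((\<lambda>t. f (g t)) has_derivative (\<lambda>s. f' (s *\<^sub>R w))) (at 0)"
    by (rule has_derivative_compose[where g = f, OF g'[unfolded has_vector_derivative_def] f'])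
  moreover have "(\<lambda>t. f (g t)) = (\<lambda>t. f (g 0))"
    by (rule ext) (rule const)
  then have "((\<lambda>t. f (g t)) has_derivative (\<lambda>s. 0)) (at 0)"
    by (simp only: has_derivative_const)
  ultimately have "(\<lambda>s. f' (s *\<^sub>R w)) = (\<lambda>s. 0)"
    by (rule has_derivative_unique)
  then show ?thesis
    by (metis scaleR_one)
qed

section \<open>The disk as a symmetric domain\<close>

lemma centered_disk_cases:
  assumes "0 < R"
  obtains "centered_disk R = UNIV" | r where "0 < r" "centered_disk R = ball 0 r"
  using assms by (cases R) (auto simp: centered_disk_def ball_def)

lemma symmetric_domain_disk:
  assumes "0 < R"
  shows "symmetric_domain (centered_disk R) 0 (\<lambda>x. x) 1 (\<lambda>x y. norm x = norm y)"
proof (rule symmetric_domain.intro)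
  show "open (centered_disk R)" "convex (centered_disk R)" "0 \<in> centered_disk R"
    by (rule centered_disk_cases[OF assms]; simp)+
  show "linear (\<lambda>x::real^2. x)"
    by (rule linear_id[unfolded id_def])
next
  fix f f' and x h :: "real^2"
  assume inv: "\<forall>x\<in>centered_disk R. \<forall>y\<in>centered_disk R. norm x = norm y \<longrightarrow> f x = (f y :: real)"
    and x: "x \<in> centered_disk R" and f': "(f has_derivative f') (at x)"
  \<comment> \<open>\<open>J\<close> is \<open>x\<close> turned by a right angle and
    \<open>g\<close> is the orbit of \<open>x\<close> under rotations, with velocity
    \<open>J\<close> at \<open>t = 0\<close>.\<close>
  define J :: "real^2" where "J = vector [- x $ 2, x $ 1]"
  define g where "g t = cos t *\<^sub>R x + sin t *\<^sub>R J" for t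
  have "norm (g t) = norm x" for t
  proof -
    have "x \<bullet> J = 0" "J \<bullet> J = x \<bullet> x"
      by (simp_all add: J_def inner_vec_def sum_2 algebra_simps)
    then have "g t \<bullet> g t = ((cos t)\<^sup>2 + (sin t)\<^sup>2) * (x \<bullet> x)"
      unfolding distrib_right power2_eq_square
      by (simp add: g_def inner_add_left inner_add_right inner_commute[of J x])
    then show ?thesis
      by (simp add: norm_eq_sqrt_inner)
  qed
  moreover from this x have "g t \<in> centered_disk R" for t
    by (simp add: centered_disk_def)
  ultimately have "f (g t) = f (g 0)" for t
    using inv by simp
  moreover have "(g has_vector_derivative J) (at 0)"
    unfolding g_def[abs_def] has_vector_derivative_def by (auto intro!: derivative_eq_intros)
  moreover have "g 0 = x"
    by (simp add: g_def)
  ultimately have J: "f' J = 0"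
    using derivative_along_level_curve[of f f' g J] f' by simp
  \<comment> \<open>Expansion of \<open>h\<close> in the orthogonal vectors \<open>x\<close> and
    \<open>J\<close> of equal length. The factor \<open>x \<bullet> x\<close> keeps it valid at the
    origin; since \<open>f' J = 0\<close>, only the radial term survives.\<close>
  have "(x \<bullet> x) *\<^sub>R h = (x \<bullet> h) *\<^sub>R x + (J \<bullet> h) *\<^sub>R J"
    by (simp add: J_def vec_eq_iff forall_2 inner_vec_def sum_2 algebra_simps)
  then have "f' ((x \<bullet> x) *\<^sub>R h) = (x \<bullet> h) * f' x + (J \<bullet> h) * f' J"
    using has_derivative_linear[OF f'] by (simp add: linear_add linear_scale)
  then show "(x - 0) \<bullet> (x - 0) * f' h = f' (x - 0) * ((x - 0) \<bullet> h)"
    using has_derivative_linear[OF f'] J by (simp add: linear_scale)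
next
  show "(axis 1 1 :: real^2) $ 1 + (axis 2 1 :: real^2) $ 2 = real (Suc 1)"
    by (simp add: axis_def)
next
  fix x y :: "real^2" and t :: real
  assume xy: "norm x = norm y"
  show "(x - 0) \<bullet> (x - 0) = (y - 0) \<bullet> (y - 0)"
    using xy by (simp add: dot_square_norm)
  show "norm (0 + t *\<^sub>R (x - 0)) = norm (0 + t *\<^sub>R (y - 0))"
    using xy by simp
qed (rule refl)+

section \<open>The strip as a symmetric domain\<close>

lemma convex_einterval: "convex (einterval a b)"
proof -
  have "is_interval (einterval a b)"
    unfolding is_interval_1 einterval_def
    by (auto intro: less_le_trans le_less_trans simp flip: ereal_less_eq(3))
  then show ?thesis
    by (rule is_interval_convex)
qed

text \<open>\<open>e\<close> and \<open>n\<close> are the unit vectors across and along the strip.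
  Orbits are the lines in direction \<open>n\<close>, and any point of the strip can serve as
  centre.\<close>

lemma symmetric_domain_strip:
  fixes A :: "real^2 \<Rightarrow> real^2" and d :: "real^2"
  assumes A: "orthogonal_transformation A" and p: "p \<in> vertical_strip a b"
  defines "\<phi> \<equiv> \<lambda>p. d + A p" and "e \<equiv> A (axis 1 1)" and "n \<equiv> A (axis 2 1)"
  shows "symmetric_domain (\<phi> ` vertical_strip a b) (\<phi> p) (\<lambda>x. (x \<bullet> e) *\<^sub>R e) 0
    (\<lambda>x y. \<exists>t. y = x + t *\<^sub>R n)"
proof -
  have lin: "linear A" and inner: "A x \<bullet> A y = x \<bullet> y" for x y
    using A by (auto simp: orthogonal_transformation_def)
  have e: "e \<bullet> e = 1" "n \<bullet> e = 0" "A k \<bullet> e = k $ 1" "A k \<bullet> n = k $ 2" for k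
    by (simp_all add: e_def n_def inner inner_axis) (simp_all add: axis_def)
  have decomp: "h = (h \<bullet> e) *\<^sub>R e + (h \<bullet> n) *\<^sub>R n" for h
  proof -
    obtain k where k: "h = A k"
      using orthogonal_transformation_surj[OF A] by (metis surjD)
    have "k = k $ 1 *\<^sub>R axis 1 1 + k $ 2 *\<^sub>R axis 2 1"
      by (simp add: vec_eq_iff forall_2 axis_def)
    then have "A k = A (k $ 1 *\<^sub>R axis 1 1 + k $ 2 *\<^sub>R axis 2 1)"
      by (rule arg_cong)
    also have "\<dots> = k $ 1 *\<^sub>R e + k $ 2 *\<^sub>R n"
      unfolding e_def n_def by (simp only: linear_add[OF lin] linear_scale[OF lin])
    finally show ?thesis
      unfolding k e .
  qed
  \<comment> \<open>A condition on one linear coordinate, from which openness and convexity can be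
    read off.\<close>
  have S: "\<phi> ` vertical_strip a b = {x. (x - d) \<bullet> e \<in> einterval a b}"
  proof (intro equalityI subsetI)
    fix x assume x: "x \<in> {x. (x - d) \<bullet> e \<in> einterval a b}"
    obtain k where k: "x - d = A k"
      using orthogonal_transformation_surj[OF A] by (metis surjD)
    then have "x = \<phi> k"
      by (simp add: \<phi>_def algebra_simps flip: k)
    then show "x \<in> \<phi> ` vertical_strip a b"
      using x k by (auto simp: vertical_strip_def e)
  qed (auto simp: \<phi>_def vertical_strip_def e)
  show ?thesis
    unfolding S
  proof (rule symmetric_domain.intro)
    have "continuous_on UNIV (\<lambda>x. (x - d) \<bullet> e)"
      by (intro continuous_intros)
    then show "open {x. (x - d) \<bullet> e \<in> einterval a b}"
      using open_vimage[OF open_einterval] by (simp add: vimage_def)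
    show "convex {x. (x - d) \<bullet> e \<in> einterval a b}"
    proof (rule convexI)
      fix x y u v assume *: "x \<in> {x. (x - d) \<bullet> e \<in> einterval a b}" "y \<in> {x. (x - d) \<bullet> e \<in> einterval a b}"
        "0 \<le> u" "0 \<le> v" "u + v = (1::real)"
      then have "u *\<^sub>R ((x - d) \<bullet> e) + v *\<^sub>R ((y - d) \<bullet> e) \<in> einterval a b"
        by (intro convexD[OF convex_einterval]) auto
      moreover have "u *\<^sub>R x + v *\<^sub>R y - d = u *\<^sub>R (x - d) + v *\<^sub>R (y - d)"
        using \<open>u + v = 1\<close> by (simp add: scaleR_diff_right flip: scaleR_left_distrib) (simp add: algebra_simps flip: scaleR_left_distrib)
      ultimately show "u *\<^sub>R x + v *\<^sub>R y \<in> {x. (x - d) \<bullet> e \<in> einterval a b}"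
        by (simp add: inner_add_left)
    qed
    show "\<phi> p \<in> {x. (x - d) \<bullet> e \<in> einterval a b}"
      using p by (simp add: \<phi>_def e vertical_strip_def)
    show "linear (\<lambda>x. (x \<bullet> e) *\<^sub>R e)"
      by (rule linearI) (simp_all add: inner_add_left scaleR_left_distrib)
    \<comment> \<open>The trace of the projection onto the line of \<open>e\<close> is
      \<open>e \<bullet> e = 1\<close>.\<close>
    show "((axis 1 1 \<bullet> e) *\<^sub>R e) $ 1 + ((axis 2 1 \<bullet> e) *\<^sub>R e) $ 2 = real (Suc 0)"
      using e(1) by (simp add: axis_def inner_vec_def sum_2)
    show "(x \<bullet> e) *\<^sub>R e \<bullet> y = x \<bullet> (y \<bullet> e) *\<^sub>R e" for x y
      by (simp add: inner_commute[of e y])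
    show "((x \<bullet> e) *\<^sub>R e \<bullet> e) *\<^sub>R e = (x \<bullet> e) *\<^sub>R e" for x
      by (simp add: e)
  next
    fix x y assume "\<exists>s. y = x + s *\<^sub>R n"
    then have "(y - \<phi> p) \<bullet> e = (x - \<phi> p) \<bullet> e"
      by (auto simp: inner_diff_left inner_add_left e)
    then show "((x - \<phi> p) \<bullet> e) *\<^sub>R e \<bullet> ((x - \<phi> p) \<bullet> e) *\<^sub>R e
        = ((y - \<phi> p) \<bullet> e) *\<^sub>R e \<bullet> ((y - \<phi> p) \<bullet> e) *\<^sub>R e"
      by (simp only:)
  next
    fix x y t assume "\<exists>s. y = x + s *\<^sub>R n"
    then obtain s where "y = x + s *\<^sub>R n" ..
    then have "\<phi> p + t *\<^sub>R (y - \<phi> p) = \<phi> p + t *\<^sub>R (x - \<phi> p) + (t * s) *\<^sub>R n"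
      by (simp add: algebra_simps)
    then show "\<exists>s. \<phi> p + t *\<^sub>R (y - \<phi> p) = \<phi> p + t *\<^sub>R (x - \<phi> p) + s *\<^sub>R n" ..
  next
    fix f f' x h
    assume inv: "\<forall>x\<in>{x. (x - d) \<bullet> e \<in> einterval a b}. \<forall>y\<in>{x. (x - d) \<bullet> e \<in> einterval a b}.
        (\<exists>t. y = x + t *\<^sub>R n) \<longrightarrow> f x = (f y :: real)"
      and x: "x \<in> {x. (x - d) \<bullet> e \<in> einterval a b}" and f': "(f has_derivative f') (at x)"
    note f'_lin = has_derivative_linear[OF f']
    define g where "g t = x + t *\<^sub>R n" for t
    have "g t \<in> {x. (x - d) \<bullet> e \<in> einterval a b}" for t
      using x by (simp add: g_def inner_diff_left inner_add_left e)
    then have "f (g t) = f x" for t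
      using inv[rule_format, OF x, of "g t"] g_def by auto
    moreover have "(g has_vector_derivative n) (at 0)"
      unfolding g_def[abs_def] has_vector_derivative_def by (auto intro!: derivative_eq_intros)
    moreover have "g 0 = x"
      by (simp add: g_def)
    ultimately have n: "f' n = 0"
      using derivative_along_level_curve[of f f' g n] f' by simp
    \<comment> \<open>The derivative along \<open>n\<close> vanishes, so \<open>f'\<close> sees only
      the component across the strip; both conditions on derivatives follow.\<close>
    have f'_eq: "f' h = (h \<bullet> e) * f' e" for h
    proof -
      have "f' h = f' ((h \<bullet> e) *\<^sub>R e + (h \<bullet> n) *\<^sub>R n)"
        by (rule arg_cong[OF decomp])
      also have "\<dots> = (h \<bullet> e) * f' e + (h \<bullet> n) * f' n"
        by (simp only: linear_add[OF f'_lin] linear_scale[OF f'_lin] real_scaleR_def)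
      finally show ?thesis
        by (simp add: n)
    qed
    show "f' ((h \<bullet> e) *\<^sub>R e) = f' h"
      by (subst (1 2) f'_eq) (simp add: e)
    show "(((x - \<phi> p) \<bullet> e) *\<^sub>R e \<bullet> ((x - \<phi> p) \<bullet> e) *\<^sub>R e) * f' h
        = f' (x - \<phi> p) * (((x - \<phi> p) \<bullet> e) *\<^sub>R e \<bullet> h)"
      unfolding f'_eq[of h] f'_eq[of "x - \<phi> p"] by (simp add: e inner_commute[of e h])
  qed
qed

theorem proposition4p6:
  fixes \<Omega> :: "(real^2) set" and R :: ereal and lam mu H :: "real^2 \<Rightarrow> real"
  assumes "0 < R"
    and "smooth_on \<Omega> lam" and "smooth_on \<Omega> mu" and "smooth_on \<Omega> H"
    and "\<forall>p\<in>\<Omega>. 0 < lam p" and "\<forall>p\<in>\<Omega>. 0 < mu p"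
    and "(\<Omega> = centered_disk R \<and> radial_on \<Omega> lam \<and> radial_on \<Omega> mu \<and> radial_on \<Omega> H)
       \<or> (\<exists>\<phi>. is_strip_via \<phi> R \<Omega> \<and> strip_invariant \<phi> \<Omega> lam
              \<and> strip_invariant \<phi> \<Omega> mu \<and> strip_invariant \<phi> \<Omega> H)"
  shows "admits_entire_spacelike_graph \<Omega> lam mu H"
  using assms(7)
proof
  assume "\<Omega> = centered_disk R \<and> radial_on \<Omega> lam \<and> radial_on \<Omega> mu \<and> radial_on \<Omega> H"
  then have \<Omega>: "\<Omega> = centered_disk R" and inv: "radial_on \<Omega> lam" "radial_on \<Omega> mu" "radial_on \<Omega> H"
    by auto
  interpret symmetric_domain \<Omega> 0 "\<lambda>x. x" 1 "\<lambda>x y. norm x = norm y"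
    unfolding \<Omega> by (rule symmetric_domain_disk[OF assms(1)])
  have "invariant f" if "radial_on \<Omega> f" for f
    using that unfolding invariant_def radial_on_def by blast
  then show ?thesis
    using assms(2-6) inv by (intro admits_entire_spacelike_graph) blast+
next
  assume "\<exists>\<phi>. is_strip_via \<phi> R \<Omega> \<and> strip_invariant \<phi> \<Omega> lam
    \<and> strip_invariant \<phi> \<Omega> mu \<and> strip_invariant \<phi> \<Omega> H"
  then obtain \<phi> where "is_strip_via \<phi> R \<Omega>"
    and inv: "strip_invariant \<phi> \<Omega> lam" "strip_invariant \<phi> \<Omega> mu" "strip_invariant \<phi> \<Omega> H"
    by blast
  then obtain A d a b where A: "orthogonal_transformation A" and \<phi>: "\<phi> = (\<lambda>p. d + A p)"
    and ab: "a < b" and \<Omega>: "\<Omega> = \<phi> ` vertical_strip a b"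
    unfolding is_strip_via_def rigid_motion_def by metis
  obtain s where "s \<in> einterval a b"
    using einterval_nonempty[OF ab] by auto
  then have "s *\<^sub>R axis 1 1 \<in> vertical_strip a b"
    by (simp add: vertical_strip_def axis_def)
  then interpret symmetric_domain \<Omega> "\<phi> (s *\<^sub>R axis 1 1)"
    "\<lambda>x. (x \<bullet> A (axis 1 1)) *\<^sub>R A (axis 1 1)" 0 "\<lambda>x y. \<exists>t. y = x + t *\<^sub>R A (axis 2 1)"
    unfolding \<Omega> \<phi> by (rule symmetric_domain_strip[OF A])
  have "invariant f" if f: "strip_invariant \<phi> \<Omega> f" for f
    unfolding invariant_def
  proof (intro ballI impI)
    fix x y assume "x \<in> \<Omega>" "\<exists>t. y = x + t *\<^sub>R A (axis 2 1)"
    then obtain p t where x: "\<phi> p \<in> \<Omega>" "x = \<phi> p" and "y = \<phi> p + t *\<^sub>R A (axis 2 1)"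
      unfolding \<Omega> by blast
    \<comment> \<open>\<open>\<phi>\<close> is affine with linear part \<open>A\<close>, so it
      carries translations along the second axis to translations along the strip.\<close>
    moreover have "\<phi> p + t *\<^sub>R A (axis 2 1) = \<phi> (p + t *\<^sub>R axis 2 1)"
      using A by (simp add: \<phi> orthogonal_transformation_def linear_add linear_scale)
    ultimately show "f x = f y"
      using f unfolding strip_invariant_def by metis
  qed
  then show ?thesis
    using assms(2-6) inv by (intro admits_entire_spacelike_graph) blast+
qed

end
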